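(* Let $n,m$ be positive integers with $\gcd(n,m)=1$, and let $G=C_n\rtimes C_m$ be a semidirect product of two cyclic groups $C_n$ and $C_m$ of orders $n$ and $m$ (with $C_n$ normal in $G$), such that $C_m$ is not normal in $G$. Then $S_c(G)<\frac{8}{21}S_c(C_{nm})$, where $C_{nm}$ is the cyclic group of order $nm$.
   Context: All groups are finite. $\mathrm{Irr}(G)$ denotes the set of complex irreducible characters of a finite group $G$. For $\chi\in\mathrm{Irr}(G)$, the codegree of $\chi$ is $\mathrm{cod}(\chi)=\frac{|G:\ker\chi|}{\chi(1)}$. The sum of codegrees is $S_c(G)=\sum_{\chi\in\mathrm{Irr}(G)}\mathrm{cod}(\chi)$. *)

theory Defs
  imports
    "HOL-Algebra.Elementary_Groups"
    "Jordan_Normal_Form.VS_Connect"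
begin

section \<open>Complex characters of a group\<close>

text \<open>The codomain is GL(d, C), the unit group of the ring of complex d by d matrices.
  Membership in \<^const>\<open>hom\<close> constrains a representation only on the carrier of the group.\<close>

definition representation ::
    "('a, 'b) monoid_scheme \<Rightarrow> nat \<Rightarrow> ('a \<Rightarrow> complex mat) \<Rightarrow> bool" where
  "representation G d \<rho> \<longleftrightarrow> \<rho> \<in> hom G (units_of (ring_mat TYPE(complex) d ()))"

definition irreducible_representation ::
    "('a, 'b) monoid_scheme \<Rightarrow> nat \<Rightarrow> ('a \<Rightarrow> complex mat) \<Rightarrow> bool" where
  "irreducible_representation G d \<rho> \<longleftrightarrow>
     representation G d \<rho> \<and> d > 0 \<and>
     (\<forall>W. VectorSpace.subspace class_ring W (module_vec TYPE(complex) d) \<longrightarrow>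
          (\<forall>g \<in> carrier G. \<forall>w \<in> W. \<rho> g *\<^sub>v w \<in> W) \<longrightarrow>
          W = {0\<^sub>v d} \<or> W = carrier_vec d)"

definition mat_trace :: "complex mat \<Rightarrow> complex" where
  "mat_trace A = (\<Sum>i<dim_row A. A $$ (i, i))"

text \<open>Characters are restricted to the carrier, so that two of them are equal as HOL functions
  exactly when they agree on the group; otherwise \<open>Irr\<close> would contain one character many times
  over.\<close>

definition character :: "('a, 'b) monoid_scheme \<Rightarrow> ('a \<Rightarrow> complex mat) \<Rightarrow> 'a \<Rightarrow> complex" where
  "character G \<rho> = (\<lambda>g \<in> carrier G. mat_trace (\<rho> g))"

definition Irr :: "('a, 'b) monoid_scheme \<Rightarrow> ('a \<Rightarrow> complex) set" where
  "Irr G = {character G \<rho> | d \<rho>. irreducible_representation G d \<rho>}"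

definition char_kernel :: "('a, 'b) monoid_scheme \<Rightarrow> ('a \<Rightarrow> complex) \<Rightarrow> 'a set" where
  "char_kernel G \<chi> = {g \<in> carrier G. \<chi> g = \<chi> \<one>\<^bsub>G\<^esub>}"

text \<open>The degree \<open>\<chi> \<one>\<close> of a character is a natural number, represented in the complex numbers;
  \<^const>\<open>Re\<close> only changes its type.\<close>

definition codegree :: "('a, 'b) monoid_scheme \<Rightarrow> ('a \<Rightarrow> complex) \<Rightarrow> real" where
  "codegree G \<chi> = real (card (rcosets\<^bsub>G\<^esub> (char_kernel G \<chi>))) / Re (\<chi> \<one>\<^bsub>G\<^esub>)"

definition sum_codegrees :: "('a, 'b) monoid_scheme \<Rightarrow> real" where
  "sum_codegrees G = (\<Sum>\<chi> \<in> Irr G. codegree G \<chi>)"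


section \<open>Semidirect products\<close>

text \<open>The internal notion: \<open>G\<close> is the semidirect product of its normal subgroup \<open>N\<close> by the
  complement \<open>H\<close>.\<close>

definition semidirect_product :: "('a, 'b) monoid_scheme \<Rightarrow> 'a set \<Rightarrow> 'a set \<Rightarrow> bool" where
  "semidirect_product G N H \<longleftrightarrow>
     N \<lhd> G \<and> subgroup H G \<and> N \<inter> H = {\<one>\<^bsub>G\<^esub>} \<and> N <#>\<^bsub>G\<^esub> H = carrier G"

end

theory Submission
  imports Defs "HOL-Computational_Algebra.Primes" "HOL-Number_Theory.Cong"
    "HOL-Algebra.Multiplicative_Group"
begin

text \<open>Let \<open>o z\<close> be the order of a root of unity \<open>z\<close> and let \<open>\<psi> k\<close> be the sum of \<open>o z\<close> over all
\<open>k\<close>-th roots of unity (\<open>order_sum\<close> below). The irreducible characters of the cyclic group of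
order \<open>k\<close> are the maps \<open>g \<mapsto> z ^ g\<close> with \<open>z ^ k = 1\<close>, and such a character has codegree \<open>o z\<close>.
Hence the right-hand side of the theorem is at least \<open>8 / 21 * \<psi> (n * m)\<close>, and \<open>\<psi> n * \<psi> m \<le> \<psi> (n * m)\<close>
for coprime \<open>n\<close> and \<open>m\<close>. It remains to bound the left-hand side by \<open>2 / 7 * \<psi> n * \<psi> m\<close>.

Let \<open>x\<close> and \<open>y\<close> generate the two cyclic factors, with \<open>x y = y x ^ s\<close>. The group generated by \<open>y\<close>
acts on the \<open>n\<close>-th roots of unity (the characters of \<open>\<langle>x\<rangle>\<close>) through \<open>z \<mapsto> z ^ s\<close>; let \<open>t\<close> be the length
of the orbit of \<open>z\<close>. An irreducible representation contains a common eigenvector \<open>v\<close> of \<open>x\<close> and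
\<open>y ^ t\<close>, with eigenvalues \<open>z\<close> and \<open>w\<close> say, where \<open>z ^ n = 1\<close> and \<open>w ^ (m / t) = 1\<close>; such a pair is
called a weight. The vectors \<open>v, y v, \<dots>, y ^ (t - 1) v\<close> span an invariant subspace, so by
irreducibility they span everything, and they are independent because they belong to distinct
eigenvalues of \<open>x\<close>. In this basis \<open>x ^ i y ^ j\<close> is a monomial matrix that depends on the
representation only through the weight (\<open>weight_basis\<close>). Three facts follow.

  \<^item> The weight determines the character (\<open>has_weight_unique\<close>).
  \<^item> The degree is \<open>t\<close> and there are at most \<open>o z * t * o w\<close> distinct matrices, so the codegree is at
    most \<open>o z * o w\<close> (\<open>has_weight_codegree_le\<close>).
  \<^item> Together with \<open>(z, w)\<close> the pair \<open>(z ^ s, w)\<close> is a weight of the same character, so that a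
    character with \<open>t \<ge> 2\<close> has at least two weights.

Spreading each codegree over the weights of its character bounds the sum of codegrees by the sum of
\<open>o z * \<psi> m\<close> over the fixed \<open>z\<close> plus the sum of \<open>o z * \<psi> (m / t) / 2\<close> over the other \<open>z\<close>.

The \<open>p\<close>-th power map gives \<open>(p\<^sup>2 - p + 1) * \<psi> k \<le> \<psi> (p * k)\<close> for every prime \<open>p\<close>; in particular
\<open>\<psi> (m / t) \<le> \<psi> m / 3\<close> if \<open>t \<ge> 2\<close>. The fixed \<open>z\<close> are the \<open>g\<close>-th roots of unity for
\<open>g = gcd n (s - 1)\<close>. As the action is nontrivial of order prime to \<open>n\<close>, the index \<open>n / g\<close> is
neither 1 nor 2, so they contribute at most \<open>\<psi> n / 7\<close> to \<open>\<psi> n\<close>. Altogether the sum of codegrees is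
at most \<open>(1 / 7 + 6 / 7 * 1 / 6) * \<psi> n * \<psi> m\<close>, which is \<open>2 / 7 * \<psi> n * \<psi> m\<close>.\<close>

section \<open>Sums of orders of roots of unity\<close>

definition root_order :: "complex \<Rightarrow> nat" where
  "root_order z = (LEAST d. d > 0 \<and> z ^ d = 1)"

definition order_sum :: "nat \<Rightarrow> real" where
  "order_sum k = (\<Sum>z | z ^ k = 1. real (root_order z))"

lemma root_order:
  assumes "z ^ k = 1" "k > 0"
  shows root_order_pos: "root_order z > 0" and power_root_order: "z ^ root_order z = 1"
proof -
  have "root_order z > 0 \<and> z ^ root_order z = 1"
    unfolding root_order_def by (rule LeastI[of _ k]) (use assms in auto)
  then show "root_order z > 0" "z ^ root_order z = 1" by auto
qed

lemma root_order_le: "z ^ k = 1 \<Longrightarrow> k > 0 \<Longrightarrow> root_order z \<le> k"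
  unfolding root_order_def by (rule Least_le) auto

lemma root_order_dvd_iff:
  assumes "z ^ k = 1" "k > 0"
  shows "z ^ j = 1 \<longleftrightarrow> root_order z dvd j"
proof
  assume "root_order z dvd j"
  then show "z ^ j = 1" by (metis power_root_order[OF assms] dvdE power_mult power_one)
next
  assume j: "z ^ j = 1"
  have "z ^ j = z ^ (root_order z * (j div root_order z) + j mod root_order z)" by simp
  also have "\<dots> = z ^ (j mod root_order z)"
    by (simp only: power_add power_mult power_root_order[OF assms] power_one mult_1)
  finally have "z ^ (j mod root_order z) = 1" using j by simp
  then have "j mod root_order z = 0"
    using root_order_le[of z "j mod root_order z"] root_order_pos[OF assms]
    by (metis gr0I leD mod_less_divisor)
  then show "root_order z dvd j" by auto
qed

text \<open>A power of \<open>z * w\<close> that is trivial stays trivial after raising it to the \<open>m\<close>-th power, which removes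
\<open>w\<close>; so the order of \<open>z\<close> divides that of \<open>z * w\<close>, and likewise for \<open>w\<close>.\<close>

lemma root_order_prod_le:
  assumes "coprime n m" "n > 0" "m > 0" "z ^ n = 1" "w ^ m = 1"
  shows "root_order z * root_order w \<le> root_order (z * w)"
proof -
  let ?d = "root_order (z * w)"
  have zw: "(z * w) ^ (n * m) = 1"
    using assms by (simp add: power_mult_distrib power_mult mult.commute[of n m])
       (metis power_mult power_one mult.commute)
  have d: "(z * w) ^ ?d = 1" "?d > 0"
    using power_root_order[OF zw] root_order_pos[OF zw] assms by auto
  have "(z * w) ^ (?d * m) = 1" "(z * w) ^ (?d * n) = 1" by (simp_all add: power_mult d)
  moreover have "w ^ (?d * m) = 1" "z ^ (?d * n) = 1"
    using assms by (simp_all add: mult.commute[of ?d] power_mult)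
  ultimately have "z ^ (?d * m) = 1" "w ^ (?d * n) = 1" by (simp_all add: power_mult_distrib)
  then have dv: "root_order z dvd ?d * m" "root_order w dvd ?d * n"
    using root_order_dvd_iff assms by metis+
  have o: "root_order z dvd n" "root_order w dvd m"
    using root_order_dvd_iff assms by metis+
  have "coprime (root_order z) m" "coprime (root_order w) n"
    "coprime (root_order z) (root_order w)"
    using o assms(1) by (meson coprime_divisors coprime_commute dvd_refl)+
  then have "root_order z * root_order w dvd ?d"
    using dv by (simp add: coprime_dvd_mult_left_iff divides_mult)
  then show ?thesis using d(2) dvd_imp_le by blast
qed

lemma order_sum_pos: "k > 0 \<Longrightarrow> order_sum k > 0"
  unfolding order_sum_def
  by (rule sum_pos2[of _ 1]) (auto simp: finite_roots_unity Suc_le_eq intro: root_order_pos)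

text \<open>Multiplication embeds the product of the groups of \<open>n\<close>-th and \<open>m\<close>-th roots of unity into the
group of \<open>(n * m)\<close>-th roots.\<close>

lemma order_sum_mult_le:
  assumes "coprime n m" "n > 0" "m > 0"
  shows "order_sum n * order_sum m \<le> order_sum (n * m)"
proof -
  let ?R = "\<lambda>k. {z::complex. z ^ k = 1}"
  let ?f = "\<lambda>(z::complex, w). z * w"
  have "inj_on ?f (?R n \<times> ?R m)"
  proof (rule inj_onI; clarsimp)
    fix z w z' w' :: complex
    assume h: "z ^ n = 1" "w ^ m = 1" "z' ^ n = 1" "w' ^ m = 1" and e: "z * w = z' * w'"
    have nz: "z' \<noteq> 0" "w \<noteq> 0" using h assms by (auto simp: power_0_left)
    define q where "q = z / z'"
    have q: "q = w' / w" using e nz by (simp add: q_def field_simps)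
    have "q ^ n = 1" by (simp add: q_def power_divide h)
    moreover have "q ^ m = 1" by (simp add: q power_divide h)
    ultimately have "root_order q dvd n" "root_order q dvd m" 
      using root_order_dvd_iff assms by metis+
    then have "root_order q = 1"
      using \<open>coprime n m\<close> by (meson coprime_common_divisor_nat)
    then have "q = 1" using power_root_order[OF \<open>q ^ n = 1\<close>] assms by simp
    then show "z = z' \<and> w = w'" using nz e q_def by simp
  qed
  moreover have "?f ` (?R n \<times> ?R m) \<subseteq> ?R (n * m)"
  proof clarsimp
    fix z w :: complex
    assume h: "z ^ n = 1" "w ^ m = 1"
    have "(z * w) ^ (n * m) = (z ^ n) ^ m * (w ^ m) ^ n"
      by (simp only: power_mult_distrib power_mult[symmetric] mult.commute[of m n])
    then show "(z * w) ^ (n * m) = 1" by (simp add: h)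
  qed
  ultimately have "(\<Sum>p\<in>?R n \<times> ?R m. real (root_order (?f p))) \<le> order_sum (n * m)"
    unfolding order_sum_def using assms
    using sum.reindex[of ?f "?R n \<times> ?R m" "\<lambda>z. real (root_order z)"]
      sum_mono2[of "?R (n * m)" "?f ` (?R n \<times> ?R m)" "\<lambda>z. real (root_order z)"]
      finite_roots_unity[of "n * m", where ?'a = complex]
    by (simp add: o_def)
  moreover have "order_sum n * order_sum m
      = (\<Sum>p\<in>?R n \<times> ?R m. real (root_order (fst p) * root_order (snd p)))"
    unfolding order_sum_def sum_product sum.cartesian_product by (simp add: case_prod_unfold)
  moreover have "\<dots> \<le> (\<Sum>p\<in>?R n \<times> ?R m. real (root_order (?f p)))"
    using root_order_prod_le[OF assms] by (intro sum_mono) (auto simp del: of_nat_mult)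
  ultimately show ?thesis by linarith
qed

lemma order_sum_mono: "j dvd k \<Longrightarrow> k > 0 \<Longrightarrow> order_sum j \<le> order_sum k"
  unfolding order_sum_def
  by (rule sum_mono2) (auto simp: finite_roots_unity power_mult elim!: dvdE)

text \<open>If \<open>p\<close> divides the order of a \<open>p\<close>-th root \<open>z\<close> of \<open>w\<close>, then that order is at least \<open>p\<close> times the
order of \<open>w\<close>. At most one of the \<open>p\<close> roots is exceptional, that is, of order prime to \<open>p\<close>, and its
order is still at least that of \<open>w\<close>, which gives the factor \<open>(p - 1) * p + 1\<close>.\<close>

lemma root_order_sum_prime_roots:
  assumes "prime p" "k > 0" "w ^ k = 1"
  shows "real (p\<^sup>2 - p + 1) * root_order w \<le> (\<Sum>z | z ^ p = w. real (root_order z))"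
proof -
  let ?S = "{z. z ^ p = w}"
  let ?A = "{z\<in>?S. p dvd root_order z}"
  have p: "p \<ge> 2" using assms prime_ge_2_nat by blast
  have w0: "w \<noteq> 0" using assms by (auto simp: power_0_left)
  have unit: "z ^ (p * k) = 1" if "z \<in> ?S" for z using that assms by (simp add: power_mult)
  have pk: "p * k > 0" using p assms by simp
  note op = root_order_pos[OF unit pk] and opw = power_root_order[OF unit pk]
  have card: "card ?S = p" using card_nth_roots[OF w0, of p] p by simp
  have fin: "finite ?S" using card p by (metis card.infinite not_numeral_le_zero)
  have big: "root_order z \<ge> p * root_order w" if "z \<in> ?A" for z
  proof -
    from that obtain e where e: "root_order z = p * e" by blast
    have "w ^ e = z ^ (p * e)" using that by (simp add: power_mult)
    also have "\<dots> = 1" using opw[of z] that e by simp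
    finally have "root_order w \<le> e" using op[of z] that e by (intro root_order_le) auto
    then show ?thesis by (simp add: e)
  qed
  have small: "root_order z \<ge> root_order w" if "z \<in> ?S" for z
  proof -
    have "w ^ root_order z = (z ^ root_order z) ^ p"
      using that by (auto simp: power_mult[symmetric] mult.commute)
    then show ?thesis using opw[OF that] op[OF that] by (intro root_order_le) auto
  qed
  \<comment> \<open>The quotient of two exceptional roots has an order that divides \<open>p\<close> and is coprime to \<open>p\<close>.\<close>
  have uniq: "z = z'" if "z \<in> ?S - ?A" "z' \<in> ?S - ?A" for z z'
  proof -
    define q where "q = z / z'"
    have "z' ^ p \<noteq> 0" using that w0 by auto
    then have z': "z' \<noteq> 0" using p by auto
    have qp: "q ^ p = 1" using that w0 by (simp add: q_def power_divide)
    have "q ^ (root_order z * root_order z') = 1"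
    proof -
      have "z ^ (root_order z * root_order z') = 1" "z' ^ (root_order z * root_order z') = 1"
        using opw[of z] opw[of z'] that
        by (simp add: power_mult, simp add: mult.commute[of "root_order z"] power_mult)
      then show ?thesis by (simp add: q_def power_divide)
    qed
    then have "root_order q dvd p" "root_order q dvd root_order z * root_order z'"
      using root_order_dvd_iff[OF qp] qp p by auto
    moreover have "coprime p (root_order z * root_order z')"
      using that \<open>prime p\<close> by (auto simp: prime_imp_coprime)
    ultimately have "root_order q = 1" by (meson coprime_common_divisor_nat)
    then have "q = 1" using power_root_order[OF qp] p by simp
    then show ?thesis using z' by (simp add: q_def)
  qed
  have "card (?S - ?A) \<le> 1" 
    unfolding One_nat_def card_le_Suc0_iff_eq[OF finite_Diff[OF fin]]
    by (intro ballI) (rule uniq)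
  moreover have "card (?S - ?A) + card ?A = p"
  proof -
    have "card (?S - ?A) = card ?S - card ?A" "card ?A \<le> card ?S"
      using fin by (auto intro!: card_Diff_subset card_mono)
    then show ?thesis using card by linarith
  qed
  ultimately have cA: "p - 1 \<le> card ?A" by linarith
  have "card ?A * (p * root_order w) \<le> (\<Sum>z\<in>?A. root_order z)"
    using sum_bounded_below[of ?A "p * root_order w" root_order] big by simp
  moreover have "card (?S - ?A) * root_order w \<le> (\<Sum>z\<in>?S - ?A. root_order z)"
    using sum_bounded_below[of "?S - ?A" "root_order w" root_order] small by simp
  moreover have "(\<Sum>z\<in>?S. root_order z) = (\<Sum>z\<in>?A. root_order z) + (\<Sum>z\<in>?S - ?A. root_order z)"
    by (subst sum.subset_diff[of ?A ?S root_order]) (use fin in auto)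
  ultimately have le: "(card ?A * p + card (?S - ?A)) * root_order w \<le> (\<Sum>z\<in>?S. root_order z)"
    by (simp add: add_mult_distrib mult.assoc)
  have "p\<^sup>2 - p + 1 \<le> card ?A * p + card (?S - ?A)"
  proof -
    have "card ?A = p - 1 \<or> card ?A = p" using cA \<open>card (?S - ?A) + card ?A = p\<close> by linarith
    then show ?thesis
    proof
      assume "card ?A = p - 1"
      moreover from this have "card (?S - ?A) = 1"
        using \<open>card (?S - ?A) + card ?A = p\<close> p by linarith
      ultimately show ?thesis by (simp add: power2_eq_square diff_mult_distrib)
    next
      assume "card ?A = p"
      moreover have "p\<^sup>2 - p + 1 \<le> p * p"
        using p le_square[of p] unfolding power2_eq_square by linarith
      ultimately show ?thesis by simp
    qed
  qed
  then have "(p\<^sup>2 - p + 1) * root_order w \<le> (\<Sum>z\<in>?S. root_order z)"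
    using le by (meson le_trans mult_le_mono1)
  then show ?thesis by (simp only: of_nat_sum[symmetric] of_nat_mult[symmetric] of_nat_le_iff)
qed

text \<open>The \<open>p\<close>-th power map sends the \<open>(p * k)\<close>-th roots of unity onto the \<open>k\<close>-th ones; sum over its fibres.\<close>

lemma order_sum_prime_mult:
  assumes "prime p" "k > 0"
  shows "real (p\<^sup>2 - p + 1) * order_sum k \<le> order_sum (p * k)"
proof -
  have p: "p > 0" using assms prime_gt_0_nat by blast
  have "real (p\<^sup>2 - p + 1) * order_sum k
      \<le> (\<Sum>w | w ^ k = 1. \<Sum>z | z ^ p = w. real (root_order z))"
    unfolding order_sum_def sum_distrib_left
    by (rule sum_mono) (use root_order_sum_prime_roots[OF assms] in auto)
  also have "\<dots> = (\<Sum>w | w ^ k = 1. \<Sum>z | z ^ (p * k) = 1 \<and> z ^ p = w. real (root_order z))"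
    by (intro sum.cong) (auto simp: power_mult)
  also have "\<dots> = order_sum (p * k)"
    unfolding order_sum_def
    using sum.group[of "{z::complex. z ^ (p * k) = 1}" "{w. w ^ k = 1}" "\<lambda>z. z ^ p"
         "\<lambda>z. real (root_order z)"] p assms
    by (simp add: finite_roots_unity[of "p * k"] finite_roots_unity[of k] image_subset_iff
        flip: power_mult)
  finally show ?thesis .
qed

lemma order_sum_mult_ge3:
  assumes "q \<ge> 2" "k > 0"
  shows "3 * order_sum k \<le> order_sum (q * k)"
proof -
  obtain p where p: "prime p" "p dvd q" 
  proof -
    have "q \<noteq> 1" using assms by simp
    then show thesis using that prime_factor_nat by blast
  qed
  have "2 * p \<le> p * p" using p(1) prime_ge_2_nat by simp
  then have "3 \<le> p\<^sup>2 - p + 1" unfolding power2_eq_square using prime_ge_2_nat[OF p(1)] by linarith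
  then have "3 \<le> real (p\<^sup>2 - p + 1)"
    by (metis of_nat_le_iff of_nat_numeral)
  then have "3 * order_sum k \<le> real (p\<^sup>2 - p + 1) * order_sum k"
    by (intro mult_right_mono) (use order_sum_pos[OF assms(2)] in linarith)+
  also have "\<dots> \<le> order_sum (p * k)" by (rule order_sum_prime_mult) fact+
  also have "\<dots> \<le> order_sum (q * k)" by (rule order_sum_mono) (use assms p in auto)
  finally show ?thesis .
qed

text \<open>An odd prime factor \<open>p\<close> of \<open>q\<close> gives the factor \<open>p\<^sup>2 - p + 1 \<ge> 7\<close>; otherwise 4 divides \<open>q\<close>, and the
factor 3 for the prime 2 occurs twice.\<close>

lemma order_sum_mult_ge7:
  assumes "q \<ge> 3" "k > 0"
  shows "7 * order_sum k \<le> order_sum (q * k)"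
proof -
  obtain p where p: "prime p" "p dvd q" 
  proof -
    have "q \<noteq> 1" using assms by simp
    then show thesis using that prime_factor_nat by blast
  qed
  show ?thesis
  proof (cases "p = 2")
    case True
    then obtain r where r: "q = 2 * r" using p by auto
    then have "r \<ge> 2" using assms by simp
    then have "3 * order_sum k \<le> order_sum (r * k)" using assms by (intro order_sum_mult_ge3) auto
    moreover have "3 * order_sum (r * k) \<le> order_sum (2 * (r * k))"
      using assms \<open>r \<ge> 2\<close> by (intro order_sum_mult_ge3) auto
    ultimately show ?thesis using order_sum_pos[OF assms(2)] r by (simp add: mult.assoc)
  next
    case False
    then have "p \<ge> 3" using prime_ge_2_nat[OF p(1)] by simp
    then have "3 * p \<le> p * p" by simp
    then have "7 \<le> p\<^sup>2 - p + 1" unfolding power2_eq_square using \<open>p \<ge> 3\<close> by linarith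
    then have "7 \<le> real (p\<^sup>2 - p + 1)"
    by (metis of_nat_le_iff of_nat_numeral)
  then have "7 * order_sum k \<le> real (p\<^sup>2 - p + 1) * order_sum k"
      by (intro mult_right_mono) (use order_sum_pos[OF assms(2)] in linarith)+
    also have "\<dots> \<le> order_sum (p * k)" by (rule order_sum_prime_mult) fact+
    also have "\<dots> \<le> order_sum (q * k)" by (rule order_sum_mono) (use assms p in auto)
    finally show ?thesis .
  qed
qed

section \<open>Eigenvectors and matrices\<close>

lemma sum_powers_roots_unity:
  assumes "0 < i" "i < k"
  shows "(\<Sum>w::complex | w ^ k = 1. w ^ i) = 0"
proof -
  define c where "c = cis (2 * pi / real k)"
  have ck: "c ^ k = 1" using assms by (simp add: c_def DeMoivre)
  then have c0: "c \<noteq> 0" using assms by (auto simp: power_0_left)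
  have "c ^ i = cis (2 * pi * real i / real k)" by (simp add: c_def DeMoivre field_simps)
  moreover have "cis (2 * pi * real i / real k) \<noteq> cis (2 * pi * real 0 / real k)"
    using bij_betw_imp_inj_on[OF bij_betw_roots_unity[of k]] assms
    by (metis gr_implies_not0 inj_onD lessThan_iff not_gr_zero)
  ultimately have ci: "c ^ i \<noteq> 1" by simp
  have bij: "bij_betw ((*) c) {w. w ^ k = 1} {w. w ^ k = 1}"
    by (rule bij_betwI[where g = "\<lambda>w. w / c"]) (auto simp: power_mult_distrib power_divide ck c0)
  have "(\<Sum>w | w ^ k = 1. w ^ i) = (\<Sum>w | w ^ k = 1. (c * w) ^ i)"
    by (rule sum.reindex_bij_betw[OF bij, symmetric])
  also have "\<dots> = c ^ i * (\<Sum>w | w ^ k = 1. w ^ i)"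
    by (simp add: power_mult_distrib sum_distrib_left)
  finally show ?thesis using ci by simp
qed

lemma sum_powers_root_unity:
  fixes z :: complex
  assumes "z ^ k = 1"
  shows "(\<Sum>i<k. z ^ i) = (if z = 1 then of_nat k else 0)"
  using assms by (simp add: geometric_sum)

text \<open>For each \<open>k\<close>-th root of unity \<open>c\<close> the sum of the vectors \<open>c ^ i A ^ i u\<close> over \<open>i < k\<close> is an
eigenvector of \<open>A\<close> for \<open>1 / c\<close> unless it vanishes. Over all \<open>c\<close> these vectors add up
to \<open>k u\<close>, so not all of them vanish. The set \<open>S\<close> stands for an invariant subspace in which the
eigenvector is to be found.\<close>

lemma periodic_eigenvector:
  fixes A :: "complex mat"
  assumes A: "A \<in> carrier_mat d d" and k: "k > 0"
    and S: "S \<subseteq> carrier_vec d" "\<And>v w. v \<in> S \<Longrightarrow> w \<in> S \<Longrightarrow> v + w \<in> S"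
      "\<And>c v. v \<in> S \<Longrightarrow> c \<cdot>\<^sub>v v \<in> S" "\<And>v. v \<in> S \<Longrightarrow> A *\<^sub>v v \<in> S"
    and u: "u \<in> S" "u \<noteq> 0\<^sub>v d" "(((*\<^sub>v) A) ^^ k) u = u"
  obtains v z where "v \<in> S" "v \<noteq> 0\<^sub>v d" "z ^ k = 1" "A *\<^sub>v v = z \<cdot>\<^sub>v v"
proof -
  define orb where "orb i = (((*\<^sub>v) A) ^^ i) u" for i
  define ps where "ps c = rec_nat (0\<^sub>v d) (\<lambda>i r. r + c ^ i \<cdot>\<^sub>v orb i)" for c :: complex
  have ps0: "ps c 0 = 0\<^sub>v d" and psS: "ps c (Suc j) = ps c j + c ^ j \<cdot>\<^sub>v orb j" for c j
    by (simp_all add: ps_def)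
  have orb0: "orb 0 = u" and orbS: "orb (Suc i) = A *\<^sub>v orb i" for i by (simp_all add: orb_def)
  have orb_in: "orb i \<in> S" for i by (induction i) (simp_all add: orb0 orbS u S)
  have uc: "u \<in> carrier_vec d" using u S(1) by blast
  have "0 \<cdot>\<^sub>v u \<in> S" using u S by blast
  moreover have "0 \<cdot>\<^sub>v u = 0\<^sub>v d" by (intro eq_vecI) (use uc in auto)
  ultimately have "0\<^sub>v d \<in> S" by simp
  then have ps_in: "ps c j \<in> S" for c j by (induction j) (simp_all add: ps0 psS S orb_in)
  have orb_c: "orb i \<in> carrier_vec d" for i using orb_in S(1) by blast
  have ps_c: "ps c i \<in> carrier_vec d" for c i using ps_in S(1) by blast
  note dims = carrier_vecD[OF orb_c] carrier_vecD[OF ps_c] carrier_matD[OF A]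
  have idx: "ps c j $ l = (\<Sum>i<j. c ^ i * orb i $ l)" if "l < d" for c j l
    by (induction j) (use that in \<open>simp_all add: ps0 psS dims\<close>)
  have shift: "c * (A *\<^sub>v ps c j) $ l + u $ l = ps c j $ l + c ^ j * orb j $ l" if "l < d" for c j l
  proof (induction j)
    case 0
    have "A *\<^sub>v 0\<^sub>v d = 0\<^sub>v d" using A by auto
    then show ?case using that by (simp add: ps0 orb0)
  next
    case (Suc j)
    have "A *\<^sub>v ps c (Suc j) = A *\<^sub>v ps c j + c ^ j \<cdot>\<^sub>v orb (Suc j)"
      using mult_add_distrib_mat_vec[OF A ps_c iffD2[OF smult_carrier_vec orb_c]]
        mult_mat_vec[OF A orb_c] by (simp add: psS orbS)
    then have "(A *\<^sub>v ps c (Suc j)) $ l = (A *\<^sub>v ps c j) $ l + c ^ j * orb (Suc j) $ l"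
      using that by (simp add: dims)
    moreover have "ps c (Suc j) $ l = ps c j $ l + c ^ j * orb j $ l"
      using that by (simp add: psS dims)
    ultimately show ?case using Suc by (simp add: algebra_simps)
  qed
  have eig: "A *\<^sub>v ps c k = (1 / c) \<cdot>\<^sub>v ps c k" if "c ^ k = 1" for c
  proof (rule eq_vecI)
    fix l assume l: "l < dim_vec ((1 / c) \<cdot>\<^sub>v ps c k)"
    have "c \<noteq> 0" using that k by (auto simp: power_0_left)
    moreover have "c * (A *\<^sub>v ps c k) $ l = ps c k $ l"
      using shift[of l c k] that u(3) l by (simp add: dims orb_def)
    ultimately show "(A *\<^sub>v ps c k) $ l = ((1 / c) \<cdot>\<^sub>v ps c k) $ l"
      using l by (simp add: field_simps)
  qed (simp add: dims)
  have "\<exists>c. c ^ k = 1 \<and> ps c k \<noteq> 0\<^sub>v d"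
  proof (rule ccontr)
    assume neg: "\<not> ?thesis"
    have "u = 0\<^sub>v d"
    proof (rule eq_vecI)
      fix l assume "l < dim_vec (0\<^sub>v d :: complex vec)"
      then have l: "l < d" by simp
      have "0 = (\<Sum>c | c ^ k = 1. ps c k $ l)"
        using neg l by (intro sum.neutral[symmetric]) auto
      also have "\<dots> = (\<Sum>c | c ^ k = 1. \<Sum>i<k. c ^ i * orb i $ l)" by (simp add: idx l)
      also have "\<dots> = (\<Sum>i<k. (\<Sum>c | c ^ k = 1. c ^ i) * orb i $ l)"
        by (subst sum.swap) (simp add: sum_distrib_right)
      also have "\<dots> = (\<Sum>i<k. if i = 0 then of_nat k * u $ l else 0)"
        by (intro sum.cong)
          (auto simp: sum_powers_roots_unity orb0 card_roots_unity_eq k)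
      also have "\<dots> = of_nat k * u $ l" using k by simp
      finally show "u $ l = 0\<^sub>v d $ l" using k l by simp
    qed (use u S in auto)
    then show False using u by simp
  qed
  then obtain c where "c ^ k = 1" "ps c k \<noteq> 0\<^sub>v d" by blast
  then show ?thesis by (intro that[OF ps_in _ _ eig]) (simp_all add: power_divide)
qed

lemma mat_trace_mult_commute:
  assumes "A \<in> carrier_mat n m" "B \<in> carrier_mat m n"
  shows "mat_trace (A * B) = mat_trace (B * A)"
proof -
  have "mat_trace (A * B) = (\<Sum>i<n. \<Sum>j<m. A $$ (i, j) * B $$ (j, i))"
    using assms by (auto simp: mat_trace_def scalar_prod_def atLeast0LessThan intro!: sum.cong)
  also have "\<dots> = (\<Sum>j<m. \<Sum>i<n. B $$ (j, i) * A $$ (i, j))"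
    by (subst sum.swap) (simp add: mult.commute)
  also have "\<dots> = mat_trace (B * A)"
    using assms by (auto simp: mat_trace_def scalar_prod_def atLeast0LessThan intro!: sum.cong)
  finally show ?thesis .
qed

lemma mat_trace_one [simp]: "mat_trace (1\<^sub>m d) = of_nat d"
  by (simp add: mat_trace_def)

text \<open>The matrix is allowed to be rectangular, since the equality of the two dimensions is a consequence
to be drawn later, from the traces of the two identity matrices.\<close>

lemma bijective_mat_inverse:
  fixes P :: "complex mat"
  assumes P: "P \<in> carrier_mat d t"
    and surj: "\<And>v. v \<in> carrier_vec d \<Longrightarrow> \<exists>w \<in> carrier_vec t. P *\<^sub>v w = v"
    and inj: "\<And>w. w \<in> carrier_vec t \<Longrightarrow> P *\<^sub>v w = 0\<^sub>v d \<Longrightarrow> w = 0\<^sub>v t"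
  obtains Q where "Q \<in> carrier_mat t d" "P * Q = 1\<^sub>m d" "Q * P = 1\<^sub>m t"
proof -
  obtain q where q: "\<And>i. q i \<in> carrier_vec t" "\<And>i. P *\<^sub>v q i = unit_vec d i"
    using surj[OF unit_vec_carrier] by metis
  define Q where "Q = mat_of_cols t (map q [0..<d])"
  have Q: "Q \<in> carrier_mat t d" by (intro carrier_matI) (simp_all add: Q_def)
  have PQ: "P * Q = 1\<^sub>m d"
  proof (rule mat_col_eqI)
    fix j assume "j < dim_col (1\<^sub>m d :: complex mat)"
    then have j: "j < d" by simp
    have "col (P * Q) j = P *\<^sub>v col Q j" by (rule col_mult2[OF P Q j])
    also have "col Q j = q j" using j q by (simp add: Q_def)
    finally show "col (P * Q) j = col (1\<^sub>m d) j" using j q by simp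
  qed (use P Q in auto)
  have QP: "Q * P = 1\<^sub>m t"
  proof (rule mat_col_eqI)
    fix j assume "j < dim_col (1\<^sub>m t :: complex mat)"
    then have j: "j < t" by simp
    define w where "w = col (Q * P) j - unit_vec t j"
    have c: "col (Q * P) j \<in> carrier_vec t" using P Q j by auto
    have "P *\<^sub>v col (Q * P) j = col (P * (Q * P)) j"
      using col_mult2[OF P mult_carrier_mat[OF Q P] j] by simp
    also have "P * (Q * P) = (P * Q) * P" using P Q by simp
    also have "\<dots> = P" using P PQ by simp
    also have "col P j = P *\<^sub>v unit_vec t j" using P j by (intro eq_vecI) simp_all
    finally have "P *\<^sub>v w = 0\<^sub>v d"
      unfolding w_def using P by (subst mult_minus_distrib_mat_vec[OF P c]) auto
    then have "w = 0\<^sub>v t" using c by (intro inj) (auto simp: w_def)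
    then show "col (Q * P) j = col (1\<^sub>m t) j"
      using c j Q unfolding w_def by (auto simp: vec_eq_iff)
  qed (use P Q in auto)
  show ?thesis using that Q PQ QP by blast
qed

lemma mat_of_cols_mult_monomial:
  fixes A :: "complex mat"
  assumes A: "A \<in> carrier_mat d d" and c: "\<And>l. l < t \<Longrightarrow> c l \<in> carrier_vec d"
    and act: "\<And>l. l < t \<Longrightarrow> A *\<^sub>v c l = a l \<cdot>\<^sub>v c (\<sigma> l)" "\<And>l. l < t \<Longrightarrow> \<sigma> l < t"
  shows "A * mat_of_cols d (map c [0..<t]) = mat_of_cols d (map c [0..<t]) *
    mat t t (\<lambda>(k, l). if k = \<sigma> l then a l else 0)" (is "A * ?P = ?P * ?M")
proof (rule eq_matI)
  fix i l assume "i < dim_row (?P * ?M)" "l < dim_col (?P * ?M)"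
  then have i: "i < d" and l: "l < t" by auto
  have "(A * ?P) $$ (i, l) = (A *\<^sub>v c l) $ i" using A c i l by simp
  also have "\<dots> = a l * c (\<sigma> l) $ i" using i carrier_vecD[OF c[OF act(2)[OF l]]] act(1)[OF l] by simp
  also have "\<dots> = (\<Sum>k<t. if k = \<sigma> l then a l * c k $ i else 0)" using act(2)[OF l] by simp
  also have "\<dots> = (\<Sum>k<t. c k $ i * (if k = \<sigma> l then a l else 0))"
    by (rule sum.cong) auto
  also have "\<dots> = (?P * ?M) $$ (i, l)" using i l
    by (auto simp: scalar_prod_def atLeast0LessThan mat_of_cols_index intro!: sum.cong)
  finally show "(A * ?P) $$ (i, l) = (?P * ?M) $$ (i, l)" .
qed (use A in auto)

lemma mat_of_cols_mult_vec_index: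
  assumes "\<And>l. l < t \<Longrightarrow> c l \<in> carrier_vec d" "w \<in> carrier_vec t" "i < d"
  shows "(mat_of_cols d (map c [0..<t]) *\<^sub>v w) $ i = (\<Sum>l<t. c l $ i * w $ l)"
  using assms by (auto simp: scalar_prod_def atLeast0LessThan mat_of_cols_index intro!: sum.cong)

section \<open>Representations of a group\<close>

lemma representation_simps:
  assumes "group G" "representation G d \<rho>"
  shows representation_closed: "g \<in> carrier G \<Longrightarrow> \<rho> g \<in> carrier_mat d d"
    and representation_mult:
      "g \<in> carrier G \<Longrightarrow> h \<in> carrier G \<Longrightarrow> \<rho> (g \<otimes>\<^bsub>G\<^esub> h) = \<rho> g * \<rho> h"
    and representation_one: "\<rho> \<one>\<^bsub>G\<^esub> = 1\<^sub>m d"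
proof -
  let ?R = "ring_mat TYPE(complex) d ()"
  interpret R: ring ?R by (rule ring_mat)
  have hom: "\<rho> \<in> hom G (units_of ?R)" using assms by (simp add: representation_def)
  show "g \<in> carrier G \<Longrightarrow> \<rho> g \<in> carrier_mat d d"
    using hom_in_carrier[OF hom] R.Units_closed by (simp add: units_of_carrier ring_mat_simps)
  show "g \<in> carrier G \<Longrightarrow> h \<in> carrier G \<Longrightarrow> \<rho> (g \<otimes>\<^bsub>G\<^esub> h) = \<rho> g * \<rho> h"
    using hom_mult[OF hom] by (simp add: units_of_mult ring_mat_simps)
  show "\<rho> \<one>\<^bsub>G\<^esub> = 1\<^sub>m d"
    using hom_one[OF hom assms(1) R.units_group] by (simp add: units_of_one ring_mat_simps)
qed

text \<open>Irreducibility in the form in which it is applied: with closure conditions in place of the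
module-theoretic notion of a subspace.\<close>

lemma irreducible_representation_invariant:
  assumes "irreducible_representation G d \<rho>"
    and W: "W \<subseteq> carrier_vec d" "\<And>v w. v \<in> W \<Longrightarrow> w \<in> W \<Longrightarrow> v + w \<in> W"
      "\<And>c v. v \<in> W \<Longrightarrow> c \<cdot>\<^sub>v v \<in> W" "\<And>g v. g \<in> carrier G \<Longrightarrow> v \<in> W \<Longrightarrow> \<rho> g *\<^sub>v v \<in> W"
    and u: "u \<in> W" "u \<noteq> 0\<^sub>v d"
  shows "W = carrier_vec d"
proof -
  interpret V: vec_space "TYPE(complex)" d .
  have uc: "u \<in> carrier_vec d" using u W by blast
  have "0 \<cdot>\<^sub>v u \<in> W" using u W by blast
  moreover have "0 \<cdot>\<^sub>v u = 0\<^sub>v d" by (intro eq_vecI) (use uc in auto)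
  ultimately have "0\<^sub>v d \<in> W" by simp
  then have "submodule class_ring W V.V"
    using W vec_module by (intro submodule.intro) (simp_all add: module_vec_simps)
  then have "VectorSpace.subspace class_ring W V.V"
    by (rule VectorSpace.subspace.intro[OF vec_vs])
  then have "W = {0\<^sub>v d} \<or> W = carrier_vec d"
    using assms(1) W(4) unfolding irreducible_representation_def by blast
  then show ?thesis using u by blast
qed

text \<open>If \<open>\<rho> g = \<rho> h\<close>, then \<open>k\<close> and \<open>k g h\<^sup>-\<^sup>1\<close> have the same matrix, so \<open>g\<close> and \<open>h\<close> span the same coset of the
kernel of the character. Counting matrices therefore bounds the index of that kernel from above.\<close>

lemma card_rcosets_char_kernel_le:
  assumes G: "group G" and rep: "representation G d \<rho>" and fin: "finite (\<rho> ` carrier G)"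
  shows "card (rcosets\<^bsub>G\<^esub> (char_kernel G (character G \<rho>))) \<le> card (\<rho> ` carrier G)"
proof -
  interpret group G by fact
  note rc = representation_closed[OF G rep] and rm = representation_mult[OF G rep]
  define K where "K = char_kernel G (character G \<rho>)"
  have Kc: "K \<subseteq> carrier G" by (auto simp: K_def char_kernel_def)
  have sub: "K #>\<^bsub>G\<^esub> g \<subseteq> K #>\<^bsub>G\<^esub> h"
    if gh: "g \<in> carrier G" "h \<in> carrier G" "\<rho> g = \<rho> h" for g h
  proof
    fix z assume "z \<in> K #>\<^bsub>G\<^esub> g"
    then obtain k where k: "k \<in> K" "z = k \<otimes>\<^bsub>G\<^esub> g" by (auto simp: r_coset_def)
    then have kc: "k \<in> carrier G" using Kc by blast
    define k' where "k' = k \<otimes>\<^bsub>G\<^esub> (g \<otimes>\<^bsub>G\<^esub> inv\<^bsub>G\<^esub> h)"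
    have k'c: "k' \<in> carrier G" using gh kc by (simp add: k'_def)
    have "\<rho> k' = \<rho> (k \<otimes>\<^bsub>G\<^esub> (h \<otimes>\<^bsub>G\<^esub> inv\<^bsub>G\<^esub> h))"
      using gh kc by (simp only: k'_def rm inv_closed m_closed)
    then have "\<rho> k' = \<rho> k" using gh kc by simp
    then have "k' \<in> K" using k k'c kc by (simp add: K_def char_kernel_def character_def)
    moreover have "z = k' \<otimes>\<^bsub>G\<^esub> h" using gh kc k by (simp add: k'_def m_assoc)
    ultimately show "z \<in> K #>\<^bsub>G\<^esub> h" by (auto simp: r_coset_def)
  qed
  have eq: "K #>\<^bsub>G\<^esub> g = K #>\<^bsub>G\<^esub> h"
    if "g \<in> carrier G" "h \<in> carrier G" "\<rho> g = \<rho> h" for g h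
    using sub[of g h] sub[of h g] that by auto
  have "rcosets\<^bsub>G\<^esub> K \<subseteq> (\<lambda>A. K #>\<^bsub>G\<^esub> inv_into (carrier G) \<rho> A) ` (\<rho> ` carrier G)"
  proof
    fix C assume "C \<in> rcosets\<^bsub>G\<^esub> K"
    then obtain g where g: "g \<in> carrier G" "C = K #>\<^bsub>G\<^esub> g" by (auto simp: RCOSETS_def)
    have "C = K #>\<^bsub>G\<^esub> inv_into (carrier G) \<rho> (\<rho> g)"
      unfolding g(2) by (rule eq) (use g in \<open>auto simp: inv_into_into f_inv_into_f\<close>)
    then show "C \<in> (\<lambda>A. K #>\<^bsub>G\<^esub> inv_into (carrier G) \<rho> A) ` (\<rho> ` carrier G)" using g by blast
  qed
  then show ?thesis unfolding K_def[symmetric] using surj_card_le[OF fin] by blast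
qed

lemma power_cong_root_unity:
  assumes "z ^ n = (1::complex)" "[a = b] (mod n)"
  shows "z ^ a = z ^ b"
proof -
  have "z ^ k = z ^ (k mod n)" for k
    by (metis assms(1) mult_1 mult_div_mod_eq power_add power_mult power_one)
  then show ?thesis using assms(2) unfolding cong_def by metis
qed

section \<open>Orbits of roots of unity under a power map\<close>

text \<open>The period of \<open>z\<close> under the map \<open>z \<mapsto> z ^ s\<close>, whose \<open>t\<close>-th iterate is \<open>z \<mapsto> z ^ (s ^ t)\<close>.\<close>

definition orbit_length :: "nat \<Rightarrow> complex \<Rightarrow> nat" where
  "orbit_length s z = (LEAST t. t > 0 \<and> z ^ (s ^ t) = z)"

context
  fixes n m s :: nat
  assumes m: "m > 0" and sm: "[s ^ m = 1] (mod n)"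
begin

lemma power_power_period:
  assumes "z ^ n = (1::complex)" "n > 0"
  shows "z ^ (s ^ m) = z"
proof -
  have "z ^ (s ^ m) = z ^ 1" using sm by (intro power_cong_root_unity[OF assms(1)])
  then show ?thesis by simp
qed

lemma orbit_length:
  assumes "z ^ n = 1" "n > 0"
  shows orbit_length_pos: "orbit_length s z > 0"
    and power_orbit_length: "z ^ (s ^ orbit_length s z) = z"
proof -
  have "orbit_length s z > 0 \<and> z ^ (s ^ orbit_length s z) = z"
    unfolding orbit_length_def
    by (rule LeastI[of _ m]) (use m power_power_period[OF assms] in auto)
  then show "orbit_length s z > 0" "z ^ (s ^ orbit_length s z) = z" by auto
qed

lemma orbit_length_le: "z ^ (s ^ t) = z \<Longrightarrow> t > 0 \<Longrightarrow> orbit_length s z \<le> t"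
  unfolding orbit_length_def by (rule Least_le) simp

lemma orbit_length_dvd:
  assumes "z ^ n = 1" "n > 0"
  shows "orbit_length s z dvd m"
proof -
  let ?t = "orbit_length s z"
  have iter: "z ^ (s ^ (?t * j)) = z" for j
    by (induction j) (simp_all add: power_add power_mult power_orbit_length[OF assms])
  have "z ^ (s ^ m) = (z ^ (s ^ (?t * (m div ?t)))) ^ (s ^ (m mod ?t))"
    by (simp flip: power_mult power_add)
  then have "z ^ (s ^ (m mod ?t)) = z" using iter power_power_period[OF assms] by simp
  then have "m mod ?t = 0"
    using orbit_length_le orbit_length_pos[OF assms] by (metis gr0I leD mod_less_divisor)
  then show ?thesis by auto
qed

text \<open>On the \<open>n\<close>-th roots of unity the \<open>m\<close>-th iterate of \<open>z \<mapsto> z ^ s\<close> is the identity, so the map is invertible.\<close>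

lemma power_power_inj:
  fixes z w :: complex
  assumes "z ^ n = 1" "w ^ n = 1" "n > 0" "z ^ (s ^ i) = w ^ (s ^ i)" "i \<le> m"
  shows "z = w"
proof -
  have eq: "u ^ (s ^ m) = (u ^ (s ^ i)) ^ (s ^ (m - i))" for u :: complex
    using assms(5) by (simp flip: power_mult power_add)
  show ?thesis
    using eq[of z] eq[of w]
    unfolding assms(4) power_power_period[OF assms(1,3)] power_power_period[OF assms(2,3)]
    by (rule trans[OF _ sym])
qed

lemma inj_on_orbit:
  assumes "z ^ n = 1" "n > 0"
  shows "inj_on (\<lambda>l. z ^ (s ^ l)) {..<orbit_length s z}"
proof -
  have "\<not> z ^ (s ^ l) = z ^ (s ^ l')" if "l < l'" "l' < orbit_length s z" for l l'
  proof
    assume eq: "z ^ (s ^ l) = z ^ (s ^ l')"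
    have "l' \<le> m" using that dvd_imp_le[OF orbit_length_dvd[OF assms]] m by linarith
    define u where "u = z ^ (s ^ (l' - l))"
    have "u ^ n = (z ^ n) ^ (s ^ (l' - l))"
      unfolding u_def power_mult[symmetric] by (simp only: mult.commute)
    then have "u ^ n = 1" using assms by simp
    moreover have "u ^ (s ^ l) = z ^ (s ^ l')"
      unfolding u_def power_mult[symmetric] power_add[symmetric] using that by simp
    ultimately have "z = u"
      using assms eq \<open>l' \<le> m\<close> that by (intro power_power_inj[of z u l]) auto
    then have "z ^ (s ^ (l' - l)) = z" by (simp add: u_def)
    then show False using orbit_length_le[of z "l' - l"] that by simp
  qed
  then show ?thesis by (intro inj_onI) (metis lessThan_iff linorder_neqE_nat)
qed

lemma orbit_length_power:
  assumes "z ^ n = 1" "n > 0"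
  shows "orbit_length s (z ^ s) = orbit_length s z"
proof -
  have "(z ^ s) ^ (s ^ t) = z ^ s \<longleftrightarrow> z ^ (s ^ t) = z" for t
  proof
    assume eq: "(z ^ s) ^ (s ^ t) = z ^ s"
    define u where "u = z ^ (s ^ t)"
    have "u ^ n = (z ^ n) ^ (s ^ t)"
      unfolding u_def power_mult[symmetric] by (simp only: mult.commute)
    then have "u ^ n = 1" using assms by simp
    moreover have "u ^ s = (z ^ s) ^ (s ^ t)"
      unfolding u_def power_mult[symmetric] by (simp only: mult.commute)
    ultimately have "u = z"
      using assms eq m by (intro power_power_inj[of u z 1]) auto
    then show "z ^ (s ^ t) = z" by (simp add: u_def)
  next
    assume "z ^ (s ^ t) = z"
    then have "(z ^ (s ^ t)) ^ s = z ^ s" by simp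
    then show "(z ^ s) ^ (s ^ t) = z ^ s"
      unfolding power_mult[symmetric] by (simp only: mult.commute)
  qed
  then show ?thesis by (simp add: orbit_length_def)
qed

lemma orbit_length_eq_1_iff:
  assumes "z ^ n = 1" "n > 0"
  shows "orbit_length s z = 1 \<longleftrightarrow> z ^ s = z"
  using orbit_length_le[of z 1] orbit_length_pos[OF assms] power_orbit_length[OF assms] by auto

end

section \<open>Irreducible characters of a split metacyclic group\<close>

text \<open>The matrix of \<open>x ^ i y ^ j\<close> in the basis \<open>v, y v, \<dots>, y ^ (t - 1) v\<close>, where \<open>x v = z v\<close> and
\<open>y ^ t v = w v\<close>: the element \<open>y ^ j\<close> moves the basis cyclically and picks up a factor \<open>w\<close> at each
passage through the end, and \<open>x ^ i\<close> acts on the \<open>k\<close>-th basis vector by \<open>z ^ (s ^ k * i)\<close>.\<close>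

definition weight_mat :: "nat \<Rightarrow> complex \<Rightarrow> complex \<Rightarrow> nat \<Rightarrow> nat \<Rightarrow> complex mat" where
  "weight_mat s z w i j = (let t = orbit_length s z in
     mat t t (\<lambda>(k, l). if k = (j + l) mod t
       then w ^ ((j + l) div t) * z ^ (s ^ ((j + l) mod t) * i) else 0))"

lemma (in group) pow_conj:
  assumes x: "x \<in> carrier G" and y: "y \<in> carrier G" and conj: "x \<otimes> y = y \<otimes> x [^] (s :: nat)"
  shows "x [^] (i :: nat) \<otimes> y = y \<otimes> x [^] (s * i)"
proof (induction i)
  case (Suc i)
  have "x [^] Suc i \<otimes> y = x \<otimes> (x [^] i \<otimes> y)" using x y nat_pow_Suc2[OF x] by (simp add: m_assoc)
  also have "\<dots> = (x \<otimes> y) \<otimes> x [^] (s * i)" using Suc x y by (simp add: m_assoc)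
  also have "\<dots> = y \<otimes> (x [^] s \<otimes> x [^] (s * i))" using conj x y by (simp add: m_assoc)
  finally show ?case using x by (simp add: nat_pow_mult)
qed (use x y in simp)

lemma (in group) pow_conj_pow:
  assumes x: "x \<in> carrier G" and y: "y \<in> carrier G" and conj: "x \<otimes> y = y \<otimes> x [^] (s :: nat)"
  shows "x [^] (i :: nat) \<otimes> y [^] (j :: nat) = y [^] j \<otimes> x [^] (s ^ j * i)"
proof (induction j)
  case (Suc j)
  have "x [^] i \<otimes> y [^] Suc j = y [^] j \<otimes> (x [^] (s ^ j * i) \<otimes> y)"
    using Suc x y by (simp add: m_assoc[symmetric])
  then show ?case using x y by (simp add: pow_conj[OF x y conj] m_assoc[symmetric] mult.assoc)
qed (use x y in simp)

text \<open>The group is described by generators and the conjugation exponent \<open>s\<close>, so that a cyclic group is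
the instance with \<open>y = \<one>\<close>, \<open>m = 1\<close> and \<open>s = 1\<close> and both sides of the theorem fall under one theory.\<close>

locale split_metacyclic = group G for G :: "('a, 'b) monoid_scheme" (structure) +
  fixes x y :: 'a and n m s :: nat
  assumes x: "x \<in> carrier G" and y: "y \<in> carrier G"
    and n: "n > 0" and m: "m > 0"
    and xn: "x [^] n = \<one>" and ym: "y [^] m = \<one>"
    and conj: "x \<otimes> y = y \<otimes> x [^] s"
    and sm: "[s ^ m = 1] (mod n)"
    and carrier: "g \<in> carrier G \<Longrightarrow> \<exists>(i :: nat) (j :: nat). g = x [^] i \<otimes> y [^] j"
begin

abbreviation orbit :: "complex \<Rightarrow> nat" where
  "orbit \<equiv> orbit_length s"

definition weight_vector ::
    "nat \<Rightarrow> ('a \<Rightarrow> complex mat) \<Rightarrow> complex \<Rightarrow> complex \<Rightarrow> complex vec \<Rightarrow> bool" where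
  "weight_vector d \<rho> z w v \<longleftrightarrow> v \<in> carrier_vec d \<and> v \<noteq> 0\<^sub>v d \<and>
     \<rho> x *\<^sub>v v = z \<cdot>\<^sub>v v \<and> \<rho> (y [^] orbit z) *\<^sub>v v = w \<cdot>\<^sub>v v"

text \<open>The pair belongs to the character: different representations with the same character share their
weights.\<close>

definition has_weight :: "('a \<Rightarrow> complex) \<Rightarrow> complex \<times> complex \<Rightarrow> bool" where
  "has_weight \<chi> = (\<lambda>(z, w). \<exists>d \<rho> v. irreducible_representation G d \<rho> \<and> \<chi> = character G \<rho> \<and>
     weight_vector d \<rho> z w v)"

text \<open>The candidates for weights: \<open>w\<close> is an eigenvalue of \<open>y ^ t\<close>, where \<open>t\<close> is the orbit length of \<open>z\<close>,
and \<open>y ^ t\<close> has an order dividing \<open>m div t\<close>.\<close>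

definition weights :: "(complex \<times> complex) set" where
  "weights = (SIGMA z:{z. z ^ n = 1}. {w. w ^ (m div orbit z) = 1})"

lemmas orbit_pos = orbit_length_pos[OF m sm _ n]
  and power_orbit = power_orbit_length[OF m sm _ n]
  and orbit_dvd = orbit_length_dvd[OF m sm _ n]

lemma finite_weights: "finite weights"
proof -
  have "m div orbit z > 0" if "z ^ n = 1" for z
    using dvd_div_eq_0_iff[OF orbit_dvd[OF that]] m by simp
  then show ?thesis
    unfolding weights_def using n by (intro finite_SigmaI) (auto simp: finite_roots_unity)
qed

lemmas x_y_pow = pow_conj_pow[OF x y conj]

context
  fixes d :: nat and \<rho> :: "'a \<Rightarrow> complex mat"
  assumes irr: "irreducible_representation G d \<rho>"
begin

lemma rep: "representation G d \<rho>" and degree_pos: "d > 0"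
  using irr by (auto simp: irreducible_representation_def)

lemmas rep_closed = representation_closed[OF is_group rep]
  and rep_mult = representation_mult[OF is_group rep]
  and rep_one = representation_one[OF is_group rep]

lemma act_mult:
  "g \<in> carrier G \<Longrightarrow> h \<in> carrier G \<Longrightarrow> v \<in> carrier_vec d \<Longrightarrow>
    \<rho> (g \<otimes> h) *\<^sub>v v = \<rho> g *\<^sub>v (\<rho> h *\<^sub>v v)"
  by (simp add: rep_mult assoc_mult_mat_vec[OF rep_closed rep_closed])

lemma act_closed: "g \<in> carrier G \<Longrightarrow> v \<in> carrier_vec d \<Longrightarrow> \<rho> g *\<^sub>v v \<in> carrier_vec d"
  using rep_closed by (rule mult_mat_vec_carrier)

lemma act_smult:
  "g \<in> carrier G \<Longrightarrow> v \<in> carrier_vec d \<Longrightarrow> \<rho> g *\<^sub>v (c \<cdot>\<^sub>v v) = c \<cdot>\<^sub>v (\<rho> g *\<^sub>v v)"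
  using rep_closed by (rule mult_mat_vec)

lemma act_eq_0: 
  assumes "g \<in> carrier G" "v \<in> carrier_vec d" "\<rho> g *\<^sub>v v = 0\<^sub>v d"
  shows "v = 0\<^sub>v d"
proof -
  have "v = \<rho> (inv g \<otimes> g) *\<^sub>v v" using assms rep_one by simp
  also have "\<dots> = \<rho> (inv g) *\<^sub>v 0\<^sub>v d" using assms act_mult[of "inv g" g v] by (simp del: l_inv)
  also have "\<dots> = 0\<^sub>v d" using rep_closed[of "inv g"] assms by (intro eq_vecI) auto
  finally show ?thesis .
qed

lemma act_pow_eig:
  assumes "g \<in> carrier G" "v \<in> carrier_vec d" "\<rho> g *\<^sub>v v = z \<cdot>\<^sub>v v"
  shows "\<rho> (g [^] (i :: nat)) *\<^sub>v v = z ^ i \<cdot>\<^sub>v v"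
proof (induction i)
  case 0
  then show ?case using assms by (simp add: rep_one)
next
  case (Suc i)
  have "\<rho> (g [^] Suc i) *\<^sub>v v = \<rho> (g [^] i) *\<^sub>v (z \<cdot>\<^sub>v v)" using assms by (simp add: act_mult)
  also have "\<dots> = z \<cdot>\<^sub>v (z ^ i \<cdot>\<^sub>v v)" using assms Suc by (simp add: act_smult)
  finally show ?case by (simp add: smult_smult_assoc)
qed

lemma funpow_act:
  assumes "g \<in> carrier G" "v \<in> carrier_vec d"
  shows "(((*\<^sub>v) (\<rho> g)) ^^ i) v = \<rho> (g [^] i) *\<^sub>v v"
proof (induction i)
  case (Suc i)
  have "g [^] Suc i = g \<otimes> g [^] i" using assms(1) by (rule nat_pow_Suc2)
  then show ?case using Suc assms by (simp add: act_mult del: nat_pow_Suc)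
qed (use assms rep_one in simp)

text \<open>The relation \<open>x y ^ t = y ^ t x ^ (s ^ t)\<close> and \<open>z ^ (s ^ t) = z\<close> show that \<open>y ^ t\<close> preserves the
eigenspace of \<open>x\<close> for \<open>z\<close>, so it has an eigenvector there.\<close>

lemma ex_weight_vector:
  obtains z w v where "(z, w) \<in> weights" "weight_vector d \<rho> z w v"
proof -
  have "unit_vec d 0 \<noteq> (0\<^sub>v d :: complex vec)" using degree_pos by simp
  moreover have "(((*\<^sub>v) (\<rho> x)) ^^ n) (unit_vec d 0) = unit_vec d 0"
    using funpow_act[OF x] xn rep_one by simp
  ultimately obtain u z where u: "u \<in> carrier_vec d" "u \<noteq> 0\<^sub>v d" "z ^ n = 1" "\<rho> x *\<^sub>v u = z \<cdot>\<^sub>v u"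
    using periodic_eigenvector[OF rep_closed[OF x] n, of "carrier_vec d" "unit_vec d 0"] act_closed[OF x]
    by (metis subset_refl add_carrier_vec smult_carrier_vec unit_vec_carrier)
  define t where "t = orbit z"
  define S where "S = {v \<in> carrier_vec d. \<rho> x *\<^sub>v v = z \<cdot>\<^sub>v v}"
  have yt: "y [^] t \<in> carrier G" using y by simp
  have S: "S \<subseteq> carrier_vec d" "u \<in> S" using u by (auto simp: S_def)
  have "v + w \<in> S" if "v \<in> S" "w \<in> S" for v w
    using that rep_closed[OF x]
    by (auto simp: S_def mult_add_distrib_mat_vec[OF rep_closed[OF x]] smult_add_distrib_vec[of _ d])
  moreover have "c \<cdot>\<^sub>v v \<in> S" if "v \<in> S" for c v
    using that by (auto simp: S_def act_smult[OF x] smult_smult_assoc mult.commute)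
  moreover have "\<rho> (y [^] t) *\<^sub>v v \<in> S" if "v \<in> S" for v
  proof -
    have v: "v \<in> carrier_vec d" "\<rho> x *\<^sub>v v = z \<cdot>\<^sub>v v" using that by (auto simp: S_def)
    have "x \<otimes> y [^] t = y [^] t \<otimes> x [^] (s ^ t)" using x_y_pow[of 1 t] x by simp
    then have "\<rho> x *\<^sub>v (\<rho> (y [^] t) *\<^sub>v v) = \<rho> (y [^] t) *\<^sub>v (\<rho> (x [^] (s ^ t)) *\<^sub>v v)"
      using x yt v by (simp flip: act_mult)
    also have "\<rho> (x [^] (s ^ t)) *\<^sub>v v = z \<cdot>\<^sub>v v"
      using act_pow_eig[OF x v] power_orbit[OF u(3)] by (simp add: t_def)
    finally show ?thesis using v act_closed[OF yt] act_smult[OF yt] by (simp add: S_def)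
  qed
  moreover have "(((*\<^sub>v) (\<rho> (y [^] t))) ^^ (m div t)) u = u"
  proof -
    have "(y [^] t) [^] (m div t) = y [^] m"
      using orbit_dvd[OF u(3)] y by (simp add: nat_pow_pow t_def)
    then show ?thesis using funpow_act[OF yt u(1)] ym rep_one u by simp
  qed
  moreover have "m div t > 0" using dvd_div_eq_0_iff[OF orbit_dvd[OF u(3)]] m by (simp add: t_def)
  ultimately obtain v w where "v \<in> S" "v \<noteq> 0\<^sub>v d" "w ^ (m div t) = 1" "\<rho> (y [^] t) *\<^sub>v v = w \<cdot>\<^sub>v v"
    using periodic_eigenvector[OF rep_closed[OF yt], of "m div t" S u] S u(2) by metis
  then show thesis using that[of z w v] u(3) 
    by (simp add: weights_def weight_vector_def S_def t_def)
qed

text \<open>Since \<open>x y = y x ^ s\<close>, the vector \<open>y v\<close> is an eigenvector of \<open>x\<close> for \<open>z ^ s\<close>, while \<open>y\<close> commutes with its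
own power.\<close>

lemma weight_vector_shift:
  assumes "weight_vector d \<rho> z w v" "z ^ n = 1"
  shows "weight_vector d \<rho> (z ^ s) w (\<rho> y *\<^sub>v v)"
proof -
  have v: "v \<in> carrier_vec d" "v \<noteq> 0\<^sub>v d" "\<rho> x *\<^sub>v v = z \<cdot>\<^sub>v v" "\<rho> (y [^] orbit z) *\<^sub>v v = w \<cdot>\<^sub>v v"
    using assms(1) by (auto simp: weight_vector_def)
  have "\<rho> x *\<^sub>v (\<rho> y *\<^sub>v v) = \<rho> y *\<^sub>v (\<rho> (x [^] s) *\<^sub>v v)"
    using x y v conj by (simp flip: act_mult)
  also have "\<dots> = z ^ s \<cdot>\<^sub>v (\<rho> y *\<^sub>v v)"
    using act_pow_eig[OF x v(1,3)] act_smult[OF y v(1)] by simp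
  finally have 1: "\<rho> x *\<^sub>v (\<rho> y *\<^sub>v v) = z ^ s \<cdot>\<^sub>v (\<rho> y *\<^sub>v v)" .
  have "\<rho> (y [^] orbit z) *\<^sub>v (\<rho> y *\<^sub>v v) = \<rho> (y \<otimes> y [^] orbit z) *\<^sub>v v"
    using y v nat_pow_Suc2[OF y, of "orbit z"] by (simp flip: act_mult)
  also have "\<dots> = w \<cdot>\<^sub>v (\<rho> y *\<^sub>v v)" using y v by (simp add: act_mult act_smult)
  finally have 2: "\<rho> (y [^] orbit z) *\<^sub>v (\<rho> y *\<^sub>v v) = w \<cdot>\<^sub>v (\<rho> y *\<^sub>v v)" .
  show ?thesis
    using 1 2 act_closed[OF y v(1)] act_eq_0[OF y v(1)] v(2)
    by (auto simp: weight_vector_def orbit_length_power[OF m sm assms(2) n])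
qed

end


text \<open>The matrix \<open>P\<close> has the columns \<open>v, y v, \<dots>, y ^ (t - 1) v\<close>. Its range is invariant, hence everything
by irreducibility. Its kernel is trivial because the columns are eigenvectors of \<open>x\<close> for distinct
eigenvalues.\<close>

lemma weight_basis:
  assumes irr: "irreducible_representation G d \<rho>" and wv: "weight_vector d \<rho> z w v"
    and zn: "z ^ n = 1"
  defines "t \<equiv> orbit z"
  obtains P Q where "P \<in> carrier_mat d t" "Q \<in> carrier_mat t d" "P * Q = 1\<^sub>m d" "Q * P = 1\<^sub>m t"
    "\<And>i j. \<rho> (x [^] i \<otimes> y [^] j) * P = P * weight_mat s z w i j"
proof -
  note rep_closed = rep_closed[OF irr] and act_mult = act_mult[OF irr] and act_smult = act_smult[OF irr]
    and act_closed = act_closed[OF irr] and act_eq_0 = act_eq_0[OF irr] and rep_one = rep_one[OF irr]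
  have v: "v \<in> carrier_vec d" "v \<noteq> 0\<^sub>v d" "\<rho> x *\<^sub>v v = z \<cdot>\<^sub>v v" "\<rho> (y [^] t) *\<^sub>v v = w \<cdot>\<^sub>v v"
    using wv by (auto simp: weight_vector_def t_def)
  have t: "t > 0" unfolding t_def by (rule orbit_pos[OF zn])
  have xi: "x [^] (i::nat) \<in> carrier G" and yj: "y [^] (j::nat) \<in> carrier G" for i j
    using x y by simp_all
  define c where "c l = \<rho> (y [^] l) *\<^sub>v v" for l :: nat
  have c: "c l \<in> carrier_vec d" for l unfolding c_def by (rule act_closed[OF yj v(1)])
  have c0: "c l \<noteq> 0\<^sub>v d" for l using act_eq_0[OF yj v(1)] v(2) by (auto simp: c_def)
  have xc: "\<rho> (x [^] i) *\<^sub>v c l = z ^ (s ^ l * i) \<cdot>\<^sub>v c l" for i l :: nat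
  proof -
    have "\<rho> (x [^] i) *\<^sub>v c l = \<rho> (y [^] l) *\<^sub>v (\<rho> (x [^] (s ^ l * i)) *\<^sub>v v)"
      using x_y_pow[of i l] v(1) xi yj by (simp add: c_def flip: act_mult)
    then show ?thesis using act_pow_eig[OF irr x v(1,3)] act_smult[OF yj v(1)] by (simp add: c_def)
  qed
  have yc: "\<rho> (y [^] j) *\<^sub>v c l = w ^ ((j + l) div t) \<cdot>\<^sub>v c ((j + l) mod t)" for j l :: nat
  proof -
    let ?q = "(j + l) div t" and ?r = "(j + l) mod t"
    have "y [^] j \<otimes> y [^] l = y [^] (?r + t * ?q)" using y by (simp add: nat_pow_mult)
    also have "\<dots> = y [^] ?r \<otimes> (y [^] t) [^] ?q" using y by (simp only: nat_pow_mult nat_pow_pow)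
    finally have "\<rho> (y [^] j) *\<^sub>v c l = \<rho> (y [^] ?r) *\<^sub>v (\<rho> ((y [^] t) [^] ?q) *\<^sub>v v)"
      using v(1) yj by (simp add: c_def flip: act_mult)
    then show ?thesis
      using act_pow_eig[OF irr yj v(1,4)] act_smult[OF yj v(1)] by (simp add: c_def)
  qed
  define P where "P = mat_of_cols d (map c [0..<t])"
  have P: "P \<in> carrier_mat d t" unfolding P_def by (intro carrier_matI) simp_all
  have inter: "\<rho> (x [^] i \<otimes> y [^] j) * P = P * weight_mat s z w i j" for i j :: nat
    unfolding P_def weight_mat_def Let_def t_def[symmetric]
  proof (rule mat_of_cols_mult_monomial)
    show "\<rho> (x [^] i \<otimes> y [^] j) *\<^sub>v c l =
      (w ^ ((j + l) div t) * z ^ (s ^ ((j + l) mod t) * i)) \<cdot>\<^sub>v c ((j + l) mod t)" for l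
      using act_mult[OF xi yj c] act_smult[OF xi c] by (simp add: yc xc smult_smult_assoc)
  qed (use rep_closed c t xi yj in auto)
  have P_index: "(P *\<^sub>v u) $ r = (\<Sum>l<t. c l $ r * u $ l)" if "u \<in> carrier_vec t" "r < d" for u r
    unfolding P_def by (rule mat_of_cols_mult_vec_index[OF c that])
  define W where "W = (\<lambda>u. P *\<^sub>v u) ` carrier_vec t"
  have "W = carrier_vec d"
  proof (rule irreducible_representation_invariant[OF irr])
    show "W \<subseteq> carrier_vec d" using P by (auto simp: W_def)
    show "a + b \<in> W" if "a \<in> W" "b \<in> W" for a b
    proof -
      from that obtain a' b' where ab: "a' \<in> carrier_vec t" "b' \<in> carrier_vec t"
        "a = P *\<^sub>v a'" "b = P *\<^sub>v b'" by (auto simp: W_def)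
      then have "a + b = P *\<^sub>v (a' + b')" using mult_add_distrib_mat_vec[OF P] by simp
      then show ?thesis using ab by (auto simp: W_def)
    qed
    show "k \<cdot>\<^sub>v a \<in> W" if "a \<in> W" for k a
    proof -
      from that obtain a' where a: "a' \<in> carrier_vec t" "a = P *\<^sub>v a'" by (auto simp: W_def)
      then have "k \<cdot>\<^sub>v a = P *\<^sub>v (k \<cdot>\<^sub>v a')" using mult_mat_vec[OF P] by simp
      then show ?thesis using a by (auto simp: W_def)
    qed
    show "\<rho> g *\<^sub>v a \<in> W" if g: "g \<in> carrier G" and "a \<in> W" for g a
    proof -
      from that obtain a' where a: "a' \<in> carrier_vec t" "a = P *\<^sub>v a'" by (auto simp: W_def)
      obtain i j :: nat where ij: "g = x [^] i \<otimes> y [^] j" using carrier[OF g] by blast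
      define M where "M = weight_mat s z w i j"
      have M: "M \<in> carrier_mat t t" by (simp add: M_def weight_mat_def Let_def t_def)
      have "\<rho> g *\<^sub>v a = (\<rho> g * P) *\<^sub>v a'"
        using a assoc_mult_mat_vec[OF rep_closed[OF g] P] by simp
      also have "\<dots> = P *\<^sub>v (M *\<^sub>v a')"
        using a assoc_mult_mat_vec[OF P M] by (simp add: ij inter M_def)
      finally show ?thesis using a M by (auto simp: W_def)
    qed
    have "P *\<^sub>v unit_vec t 0 = col P 0" using P t by (intro eq_vecI) simp_all
    also have "\<dots> = v" using t v c rep_one by (simp add: P_def c_def)
    finally show "v \<in> W" by (force simp: W_def)
    show "v \<noteq> 0\<^sub>v d" by fact
  qed
  have surj: "\<exists>u\<in>carrier_vec t. P *\<^sub>v u = a" if "a \<in> carrier_vec d" for a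
  proof -
    have "a \<in> W" using that \<open>W = carrier_vec d\<close> by simp
    then show ?thesis by (auto simp: W_def)
  qed
  have inj: "u = 0\<^sub>v t" if u: "u \<in> carrier_vec t" "P *\<^sub>v u = 0\<^sub>v d" for u
  proof (rule eq_vecI)
    fix k assume "k < dim_vec (0\<^sub>v t :: complex vec)"
    then have k: "k < t" by simp
    define e where "e l = z ^ (s ^ l)" for l
    have e: "e l ^ n = 1" for l
      unfolding e_def power_mult[symmetric] mult.commute[of _ n] by (simp add: power_mult zn)
    have e0: "e l \<noteq> 0" for l using e[of l] n by (auto simp: power_0_left)
    obtain r where r: "r < d" "c k $ r \<noteq> 0"
      using c0[of k] c[of k] by (auto simp: vec_eq_iff)
    have rel: "(\<Sum>l<t. c l $ r * (e l ^ i * u $ l)) = 0" for i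
    proof -
      define a where "a = vec t (\<lambda>l. e l ^ i * u $ l)"
      have a: "a \<in> carrier_vec t" by (simp add: a_def)
      define M where "M = weight_mat s z w i 0"
      have M: "M \<in> carrier_mat t t" by (simp add: M_def weight_mat_def Let_def t_def)
      have "M *\<^sub>v u = a"
      proof (rule eq_vecI)
        fix l assume "l < dim_vec a"
        then have l: "l < t" by (simp add: a_def)
        have "(M *\<^sub>v u) $ l = (\<Sum>l'<t. M $$ (l, l') * u $ l')"
          using M u(1) l by (auto simp: scalar_prod_def atLeast0LessThan intro!: sum.cong)
        also have "\<dots> = (\<Sum>l'<t. if l' = l then e l ^ i * u $ l else 0)"
          using l by (intro sum.cong)
            (auto simp: M_def weight_mat_def Let_def t_def[symmetric] e_def power_mult)
        finally show "(M *\<^sub>v u) $ l = a $ l" using l by (simp add: a_def)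
      qed (use M in \<open>simp add: a_def\<close>)
      then have "P *\<^sub>v a = (P * M) *\<^sub>v u" using assoc_mult_mat_vec[OF P M u(1)] by simp
      also have "\<dots> = \<rho> (x [^] i \<otimes> y [^] (0::nat)) *\<^sub>v (P *\<^sub>v u)"
        using assoc_mult_mat_vec[OF rep_closed[OF m_closed[OF xi yj]] P u(1)]
        by (simp only: M_def inter)
      also have "\<dots> = 0\<^sub>v d"
        unfolding u(2) by (intro eq_vecI) (use rep_closed[of "x [^] i \<otimes> y [^] (0::nat)"] xi yj in auto)
      finally show ?thesis using P_index[OF a r(1)] r(1) by (simp add: a_def)
    qed
    \<comment> \<open>Averaging over the powers of \<open>x\<close> projects onto the eigenspace of the \<open>k\<close>-th eigenvalue.\<close>
    have "0 = (\<Sum>i<n. (1 / e k) ^ i * (\<Sum>l<t. c l $ r * (e l ^ i * u $ l)))" by (simp add: rel)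
    also have "\<dots> = (\<Sum>l<t. c l $ r * u $ l * (\<Sum>i<n. (e l / e k) ^ i))"
      unfolding sum_distrib_left
      by (subst sum.swap) (simp add: power_divide mult_ac)
    also have "\<dots> = (\<Sum>l<t. if l = k then c k $ r * u $ k * of_nat n else 0)"
    proof (intro sum.cong refl)
      fix l assume "l \<in> {..<t}"
      then have "e l = e k \<longleftrightarrow> l = k"
        using inj_onD[OF inj_on_orbit[OF m sm zn n], of l k] k by (auto simp: t_def e_def)
      moreover have "(e l / e k) ^ n = 1" by (simp add: power_divide e)
      ultimately show "c l $ r * u $ l * (\<Sum>i<n. (e l / e k) ^ i) =
          (if l = k then c k $ r * u $ k * of_nat n else 0)"
        using sum_powers_root_unity[of "e l / e k" n] e0 by auto
    qed
    also have "\<dots> = c k $ r * u $ k * of_nat n" using k by simp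
    finally show "u $ k = 0\<^sub>v t $ k" using r n k by simp
  qed (use u in simp)
  obtain Q where "Q \<in> carrier_mat t d" "P * Q = 1\<^sub>m d" "Q * P = 1\<^sub>m t"
    using bijective_mat_inverse[OF P surj inj] by blast
  then show thesis using that[OF P] inter by blast
qed

text \<open>With \<open>Q\<close> inverse to \<open>P\<close> the matrix \<open>\<rho> g = P * M * Q\<close> has the trace of \<open>M * Q * P = M\<close>; for \<open>g = \<one>\<close>
this compares the sizes of the two identity matrices.\<close>

lemma weight_degree_character:
  assumes irr: "irreducible_representation G d \<rho>" and wv: "weight_vector d \<rho> z w v"
    and zn: "z ^ n = 1"
  shows weight_degree: "d = orbit z"
    and weight_character: "mat_trace (\<rho> (x [^] i \<otimes> y [^] j)) = mat_trace (weight_mat s z w i j)"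
    and weight_trivial: "weight_mat s z w i j = 1\<^sub>m (orbit z) \<Longrightarrow> \<rho> (x [^] i \<otimes> y [^] j) = 1\<^sub>m d"
proof -
  let ?t = "orbit z"
  obtain P Q where P: "P \<in> carrier_mat d ?t" and Q: "Q \<in> carrier_mat ?t d"
    and PQ: "P * Q = 1\<^sub>m d" and QP: "Q * P = 1\<^sub>m ?t"
    and inter: "\<And>i j. \<rho> (x [^] i \<otimes> y [^] j) * P = P * weight_mat s z w i j"
    using weight_basis[OF irr wv zn] by metis
  have "of_nat d = (of_nat ?t :: complex)"
    using mat_trace_mult_commute[OF P Q] by (simp add: PQ QP)
  then show "d = ?t" by simp
  define A where "A = \<rho> (x [^] i \<otimes> y [^] j)"
  define M where "M = weight_mat s z w i j"
  have A: "A \<in> carrier_mat d d" unfolding A_def using rep_closed[OF irr] x y by simp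
  have M: "M \<in> carrier_mat ?t ?t" by (simp add: M_def weight_mat_def Let_def)
  have "A = A * (P * Q)" using A by (simp add: PQ)
  also have "\<dots> = P * M * Q" 
    using assoc_mult_mat[OF A P Q] inter by (simp add: A_def M_def)
  finally have AP: "A = P * M * Q" .
  also have "mat_trace (P * M * Q) = mat_trace (Q * (P * M))"
    using P M Q by (intro mat_trace_mult_commute[of _ d ?t]) auto
  also have "Q * (P * M) = M" using assoc_mult_mat[OF Q P M] M by (simp add: QP)
  finally show "mat_trace (\<rho> (x [^] i \<otimes> y [^] j)) = mat_trace (weight_mat s z w i j)"
    by (simp add: A_def M_def)
  show "\<rho> (x [^] i \<otimes> y [^] j) = 1\<^sub>m d" if "weight_mat s z w i j = 1\<^sub>m ?t"
    using AP P PQ that by (simp add: A_def M_def)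
qed

lemma has_weight_unique:
  assumes "has_weight \<chi> p" "has_weight \<chi>' p" "p \<in> weights"
  shows "\<chi> = \<chi>'"
proof
  fix g
  obtain z w where p: "p = (z, w)" by (cases p)
  have zn: "z ^ n = 1" using assms(3) p by (auto simp: weights_def)
  show "\<chi> g = \<chi>' g"
  proof (cases "g \<in> carrier G")
    case True
    then obtain i j :: nat where g: "g = x [^] i \<otimes> y [^] j" using carrier by blast
    have val: "\<psi> g = mat_trace (weight_mat s z w i j)" if hw: "has_weight \<psi> p" for \<psi>
    proof -
      from hw obtain d \<rho> v where "irreducible_representation G d \<rho>" "\<psi> = character G \<rho>"
        "weight_vector d \<rho> z w v" by (auto simp: p has_weight_def)
      then show ?thesis using weight_character[OF _ _ zn] True by (simp add: character_def g)
    qed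
    show ?thesis using val[OF assms(1)] val[OF assms(2)] by simp
  next
    case False
    have val: "\<psi> g = undefined" if "has_weight \<psi> p" for \<psi>
      using that False by (auto simp: p has_weight_def character_def)
    show ?thesis using val[OF assms(1)] val[OF assms(2)] by simp
  qed
qed

text \<open>The matrices of \<open>x ^ o z\<close> and \<open>y ^ (t * o w)\<close> are trivial, so there are at most \<open>o z * t * o w\<close>
different matrices; dividing by the degree \<open>t\<close> gives the bound.\<close>

lemma has_weight_codegree_le:
  assumes hw: "has_weight \<chi> (z, w)" and "(z, w) \<in> weights"
  shows "codegree G \<chi> \<le> real (root_order z * root_order w)"
proof -
  let ?t = "orbit z"
  have zn: "z ^ n = 1" and wm: "w ^ (m div ?t) = 1" using assms(2) by (auto simp: weights_def)
  have mt: "m div ?t > 0" using dvd_div_eq_0_iff[OF orbit_dvd[OF zn]] m by simp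
  define a where "a = root_order z"
  define b where "b = root_order w"
  have a: "a > 0" "z ^ a = 1" unfolding a_def using root_order[OF zn n] by auto
  have b: "b > 0" "w ^ b = 1" unfolding b_def using root_order[OF wm mt] by auto
  have t: "?t > 0" by (rule orbit_pos[OF zn])
  obtain d \<rho> v where irr: "irreducible_representation G d \<rho>" and \<chi>: "\<chi> = character G \<rho>"
    and wv: "weight_vector d \<rho> z w v" using hw by (auto simp: has_weight_def)
  note rep = rep[OF irr]
  have d: "d = ?t" by (rule weight_degree[OF irr wv zn])
  have xi: "x [^] (i::nat) \<in> carrier G" and yj: "y [^] (j::nat) \<in> carrier G" for i j
    using x y by simp_all
  have "z ^ (s ^ l * a) = 1" for l
    using a(2) by (simp add: mult.commute[of _ a] power_mult)
  then have "weight_mat s z w a 0 = 1\<^sub>m ?t"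
    using t by (intro eq_matI) (auto simp: weight_mat_def Let_def)
  then have xa: "\<rho> (x [^] a) = 1\<^sub>m d"
    using weight_trivial[OF irr wv zn, of a 0] x by simp
  have "weight_mat s z w 0 (?t * b) = 1\<^sub>m ?t"
    using t b by (intro eq_matI) (auto simp: weight_mat_def Let_def)
  then have yb: "\<rho> (y [^] (?t * b)) = 1\<^sub>m d"
    using weight_trivial[OF irr wv zn, of 0 "?t * b"] y by simp
  have pow_one: "\<rho> (g [^] (k * i)) = 1\<^sub>m d"
    if "g \<in> carrier G" "\<rho> (g [^] k) = 1\<^sub>m d" for g and k i :: nat
  proof (induction i)
    case (Suc i)
    have "g [^] (k * Suc i) = g [^] k \<otimes> g [^] (k * i)" using that by (simp add: nat_pow_mult)
    then show ?case using Suc that rep_mult[OF irr] by simp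
  qed (use rep_one[OF irr] in simp)
  have red: "\<rho> (g [^] i) = \<rho> (g [^] (i mod k))"
    if "g \<in> carrier G" "\<rho> (g [^] k) = 1\<^sub>m d" for g and k i :: nat
  proof -
    have "g [^] i = g [^] (k * (i div k)) \<otimes> g [^] (i mod k)" using that by (simp add: nat_pow_mult)
    then have "\<rho> (g [^] i) = \<rho> (g [^] (k * (i div k))) * \<rho> (g [^] (i mod k))"
      using rep_mult[OF irr] that(1) by simp
    then show ?thesis
      using left_mult_one_mat[OF rep_closed[OF irr], of "g [^] (i mod k)"] that(1)
      by (simp only: pow_one[OF that] nat_pow_closed)
  qed
  let ?F = "\<lambda>(i, j). \<rho> (x [^] (i::nat)) * \<rho> (y [^] (j::nat))"
  let ?I = "{..<a} \<times> {..<?t * b}"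
  have im: "\<rho> ` carrier G \<subseteq> ?F ` ?I"
  proof
    fix A assume "A \<in> \<rho> ` carrier G"
    then obtain i j :: nat where "A = \<rho> (x [^] i \<otimes> y [^] j)" using carrier by blast
    then have "A = \<rho> (x [^] (i mod a)) * \<rho> (y [^] (j mod (?t * b)))"
      using rep_mult[OF irr xi yj] red[OF x xa] red[OF y yb] by metis
    then show "A \<in> ?F ` ?I" using a b t by (intro image_eqI[of _ _ "(i mod a, j mod (?t * b))"]) auto
  qed
  have fin: "finite (\<rho> ` carrier G)" using im by (rule finite_subset) simp
  have "card (rcosets (char_kernel G \<chi>)) \<le> card (\<rho> ` carrier G)"
    unfolding \<chi> by (rule card_rcosets_char_kernel_le[OF is_group rep fin])
  also have "\<dots> \<le> card ?I" using surj_card_le[OF _ im] by simp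
  also have "card ?I = a * b * ?t" by (simp add: card_cartesian_product)
  finally have "real (card (rcosets (char_kernel G \<chi>))) \<le> real (a * b) * real ?t"
    by (simp only: of_nat_mult[symmetric] of_nat_le_iff)
  moreover have "Re (\<chi> \<one>) = real ?t" by (simp add: \<chi> character_def rep_one[OF irr] d)
  ultimately show ?thesis using t by (simp add: codegree_def divide_le_eq a_def b_def)
qed

text \<open>Distinct characters have disjoint sets of weights, and each set is large enough to carry the
codegree: the single term of \<open>(z, w)\<close> suffices if \<open>z\<close> is fixed, and otherwise the terms of
\<open>(z, w)\<close> and \<open>(z ^ s, w)\<close> contribute at least one half of the codegree each.\<close>

lemma sum_codegrees_le_weights:
  shows finite_Irr: "finite (Irr G)"
    and sum_codegrees_le: "sum_codegrees G \<le> (\<Sum>(z, w)\<in>weights.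
      real (root_order z * root_order w) / (if z ^ s = z then 1 else 2))"
proof -
  define f :: "complex \<times> complex \<Rightarrow> real" where "f = (\<lambda>(z, w). 
      real (root_order z * root_order w) / (if z ^ s = z then 1 else 2))"
  define Wt where "Wt \<chi> = {p \<in> weights. has_weight \<chi> p}" for \<chi>
  have fin: "finite (Wt \<chi>)" for \<chi> using finite_weights by (simp add: Wt_def)
  have disj: "Wt \<chi> \<inter> Wt \<chi>' = {}" if "\<chi> \<noteq> \<chi>'" for \<chi> \<chi>'
    using has_weight_unique that by (auto simp: Wt_def)
  have f0: "f p \<ge> 0" for p by (auto simp: f_def split: prod.splits)
  have ne: "\<exists>z w. (z, w) \<in> Wt \<chi> \<and> (z ^ s, w) \<in> Wt \<chi>" if "\<chi> \<in> Irr G" for \<chi>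
  proof -
    from that obtain d \<rho> where irr: "irreducible_representation G d \<rho>"
      and \<chi>: "\<chi> = character G \<rho>" by (auto simp: Irr_def)
    obtain z w v where zw: "(z, w) \<in> weights" and wv: "weight_vector d \<rho> z w v"
      using ex_weight_vector[OF irr] .
    have zn: "z ^ n = 1" using zw by (simp add: weights_def)
    have "(z ^ s) ^ n = 1"
      unfolding power_mult[symmetric] mult.commute[of _ n] by (simp add: power_mult zn)
    then have "(z ^ s, w) \<in> weights"
      using zw orbit_length_power[OF m sm zn n] by (simp add: weights_def)
    then show ?thesis using zw wv weight_vector_shift[OF irr wv zn] irr \<chi>
      unfolding Wt_def has_weight_def by blast
  qed
  have "inj_on Wt (Irr G)" using ne disj by (intro inj_onI) blast
  moreover have "Wt ` Irr G \<subseteq> Pow weights" by (auto simp: Wt_def)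
  ultimately show fI: "finite (Irr G)" using finite_weights by (meson finite_Pow_iff inj_on_finite)
  have le: "codegree G \<chi> \<le> (\<Sum>p\<in>Wt \<chi>. f p)" if \<chi>: "\<chi> \<in> Irr G" for \<chi>
  proof -
    obtain z w where zw: "(z, w) \<in> Wt \<chi>" "(z ^ s, w) \<in> Wt \<chi>" using ne[OF \<chi>] by blast
    have cod: "codegree G \<chi> \<le> real (root_order z * root_order w)"
      "codegree G \<chi> \<le> real (root_order (z ^ s) * root_order w)"
      using zw has_weight_codegree_le by (auto simp: Wt_def)
    show ?thesis
    proof (cases "z ^ s = z")
      case True
      then have "codegree G \<chi> \<le> f (z, w)" using cod by (simp add: f_def)
      also have "\<dots> \<le> (\<Sum>p\<in>Wt \<chi>. f p)" using zw fin f0 by (intro member_le_sum) auto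
      finally show ?thesis .
    next
      case False
      have zn: "z ^ n = 1" using zw by (simp add: Wt_def weights_def)
      have zsn: "(z ^ s) ^ n = 1" using zw by (simp add: Wt_def weights_def)
      have "(z ^ s) ^ s \<noteq> z ^ s"
        using False orbit_length_eq_1_iff[OF m sm zn n] orbit_length_eq_1_iff[OF m sm zsn n]
          orbit_length_power[OF m sm zn n] by simp
      then have "codegree G \<chi> \<le> f (z, w) + f (z ^ s, w)" using cod False by (simp add: f_def)
      also have "\<dots> = (\<Sum>p\<in>{(z, w), (z ^ s, w)}. f p)" using False by simp
      also have "\<dots> \<le> (\<Sum>p\<in>Wt \<chi>. f p)" using zw fin f0 by (intro sum_mono2) auto
      finally show ?thesis .
    qed
  qed
  have "sum_codegrees G \<le> (\<Sum>\<chi>\<in>Irr G. \<Sum>p\<in>Wt \<chi>. f p)"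
    unfolding sum_codegrees_def by (rule sum_mono) (rule le)
  also have "\<dots> = (\<Sum>p\<in>(\<Union>\<chi>\<in>Irr G. Wt \<chi>). f p)"
    using fI fin disj by (intro sum.UNION_disjoint[symmetric]) auto
  also have "\<dots> \<le> (\<Sum>p\<in>weights. f p)"
    using finite_weights f0 by (intro sum_mono2) (auto simp: Wt_def)
  finally show "sum_codegrees G \<le> (\<Sum>(z, w)\<in>weights.
      real (root_order z * root_order w) / (if z ^ s = z then 1 else 2))"
    by (simp add: f_def)
qed

end

section \<open>The bound for split metacyclic groups\<close>

text \<open>The index 1 is excluded because the action is nontrivial. If the index were 2, then \<open>n\<close> would be
even, so \<open>s\<close> and \<open>m\<close> would be odd; as 2 divides \<open>s + 1\<close> and \<open>n / 2\<close> divides \<open>s - 1\<close>, the square of \<open>s\<close>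
would be 1 modulo \<open>n\<close>, whence \<open>s = s ^ m = 1\<close>.\<close>

lemma fixed_roots_index_ge3:
  fixes n m s :: nat
  assumes "n > 0" "coprime n m" "[s ^ m = 1] (mod n)" "\<not> [s = 1] (mod n)"
  obtains q where "n = q * gcd n (s - 1)" "q \<ge> 3"
proof -
  define g where "g = gcd n (s - 1)"
  have gn: "g dvd n" and gs: "g dvd s - 1" by (simp_all add: g_def)
  obtain q where q: "n = q * g" using gn by (metis dvdE mult.commute)
  have m0: "m > 0" if "n \<noteq> 1" using assms(2) that by (cases m) auto
  have n1: "n \<noteq> 1" using assms(4) by auto
  have s0: "s > 0"
  proof (rule ccontr)
    assume "\<not> s > 0"
    then have "[0 = 1] (mod n)" using assms(3) m0[OF n1] by (simp add: power_0_left)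
    then show False using n1 by (simp add: cong_0_1_nat' cong_sym_eq)
  qed
  have ndvd: "\<not> n dvd s - 1"
    using assms(4) s0 by (simp add: cong_altdef_nat)
  have "q \<noteq> 0" using q assms(1) by auto
  moreover have "q \<noteq> 1" using q ndvd gs by auto
  moreover have "q \<noteq> 2"
  proof
    assume q2: "q = 2"
    have "even n" using q q2 by simp
    then have "odd m" using assms(2) by (metis coprime_common_divisor odd_one)
    have "[s ^ m = 1] (mod 2)" using assms(3) \<open>even n\<close> by (rule cong_dvd_modulus_nat)
    then have "s ^ m mod 2 = 1" by (simp add: cong_def)
    then have "odd (s ^ m)" by presburger
    then have "odd s" using m0[OF n1] by simp
    then have "2 dvd s + 1" by simp
    then have "2 * g dvd (s + 1) * (s - 1)" using gs by (rule mult_dvd_mono)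
    also have "(s + 1) * (s - 1) = s ^ 2 - 1"
      by (simp add: power2_eq_square diff_mult_distrib2)
    finally have "[s ^ 2 = 1] (mod n)" using s0 q q2 by (simp add: cong_altdef_nat)
    then have "[s ^ (2 * (m div 2)) = 1] (mod n)"
      unfolding power_mult using cong_pow by fastforce
    then have "[s * s ^ (2 * (m div 2)) = s * 1] (mod n)" by (rule cong_scalar_left)
    moreover have "s * s ^ (2 * (m div 2)) = s ^ m"
      using \<open>odd m\<close> by (metis odd_two_times_div_two_succ power_Suc Suc_eq_plus1)
    ultimately have "[s = 1] (mod n)" using assms(3) by (metis cong_sym cong_trans mult.right_neutral)
    then show False using assms(4) by simp
  qed
  ultimately have "q \<ge> 3" by linarith
  then show thesis using that q unfolding g_def by blast
qed

text \<open>The fixed points are \<open>gcd n (s - 1)\<close>-th roots of unity.\<close>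

lemma fixed_roots_order_sum_le:
  fixes n m s :: nat
  assumes n: "n > 0" and "coprime n m" "[s ^ m = 1] (mod n)" "\<not> [s = 1] (mod n)" and s: "s > 0"
  shows "7 * (\<Sum>z | z ^ n = 1 \<and> z ^ s = z. real (root_order z)) \<le> order_sum n"
proof -
  define g where "g = gcd n (s - 1)"
  obtain q where q: "n = q * g" "q \<ge> 3"
    using fixed_roots_index_ge3[OF assms(1-4)] unfolding g_def .
  have g: "g > 0" using q n by (auto intro: Nat.gr0I)
  have "z ^ g = 1" if z: "z ^ n = 1" "z ^ s = z" for z :: complex
  proof -
    have "z \<noteq> 0" using z n by (auto simp: power_0_left)
    moreover have "z ^ s = z ^ (s - 1) * z" using s by (metis Suc_diff_1 power_Suc2)
    ultimately have "z ^ (s - 1) = 1" using z by simp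
    then have "root_order z dvd g" using root_order_dvd_iff[OF z(1) n] z by (simp add: g_def)
    then show ?thesis using root_order_dvd_iff[OF z(1) n] by simp
  qed
  then have "(\<Sum>z | z ^ n = 1 \<and> z ^ s = z. real (root_order z)) \<le> order_sum g"
    unfolding order_sum_def using g by (intro sum_mono2) (auto simp: finite_roots_unity)
  also have "7 * order_sum g \<le> order_sum n" using order_sum_mult_ge7[OF q(2) g] q(1) by simp
  finally show ?thesis by simp
qed

text \<open>A root \<open>z\<close> that is not fixed has an orbit of length \<open>t \<ge> 2\<close>, which costs a factor \<open>1 / 3\<close> in passing
from \<open>\<psi> m\<close> to \<open>\<psi> (m / t)\<close> and a factor \<open>1 / 2\<close> for the two weights. The worst case is that fixed
roots account for one seventh of \<open>\<psi> n\<close>: \<open>1 / 7 + 6 / 7 * 1 / 6 = 2 / 7\<close>.\<close>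

lemma (in split_metacyclic) sum_codegrees_le_two_sevenths:
  assumes "coprime n m" "\<not> [s = 1] (mod n)" "s > 0"
  shows "sum_codegrees G \<le> 2 / 7 * (order_sum n * order_sum m)"
proof -
  define A where "A = (\<Sum>z | z ^ n = 1 \<and> z ^ s = z. real (root_order z))"
  define B where "B = (\<Sum>z | z ^ n = 1 \<and> z ^ s \<noteq> z. real (root_order z))"
  have fin: "finite {z :: complex. z ^ n = 1}" using n by (simp add: finite_roots_unity)
  have AB: "A + B = order_sum n"
    unfolding A_def B_def order_sum_def
    by (subst sum.union_disjoint[symmetric]) (use fin in \<open>auto intro!: sum.cong\<close>)
  have A7: "7 * A \<le> order_sum n"
    unfolding A_def by (rule fixed_roots_order_sum_le[OF n assms(1) sm assms(2,3)])
  have psi: "(\<Sum>w | w ^ (m div orbit z) = 1. real (root_order z * root_order w) / c)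
      = real (root_order z) * order_sum (m div orbit z) / c" for z c
    by (simp add: order_sum_def sum_distrib_left sum_divide_distrib)
  have term_le: "real (root_order z) * order_sum (m div orbit z) / (if z ^ s = z then 1 else 2)
      \<le> real (root_order z) * (order_sum m * (if z ^ s = z then 1 else 1 / 6))" (is "?l \<le> ?r")
    if z: "z ^ n = 1" for z
  proof -
    have dvd: "orbit z dvd m" by (rule orbit_dvd[OF z])
    have "order_sum (m div orbit z) / (if z ^ s = z then 1 else 2)
        \<le> order_sum m * (if z ^ s = z then 1 else 1 / 6)"
    proof (cases "z ^ s = z")
      case True
      have "m div orbit z dvd m" using dvd by (metis dvd_div_mult_self dvd_triv_left)
      then show ?thesis using True m by (simp add: order_sum_mono)
    next
      case False
      then have "orbit z \<ge> 2"
        using orbit_length_eq_1_iff[OF m sm z n] orbit_pos[OF z] by linarith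
      moreover have "m div orbit z > 0" using dvd_div_eq_0_iff[OF dvd] m by simp
      ultimately have "3 * order_sum (m div orbit z) \<le> order_sum (orbit z * (m div orbit z))"
        by (rule order_sum_mult_ge3)
      then show ?thesis using False dvd by simp
    qed
    then have "real (root_order z) * (order_sum (m div orbit z) / (if z ^ s = z then 1 else 2)) \<le> ?r"
      by (rule mult_left_mono) simp
    then show ?thesis by simp
  qed
  have "sum_codegrees G \<le> (\<Sum>z | z ^ n = 1. real (root_order z) *
      order_sum (m div orbit z) / (if z ^ s = z then 1 else 2))"
  proof -
    have "(\<Sum>(z, w)\<in>weights. real (root_order z * root_order w) / (if z ^ s = z then 1 else 2)) =
      (\<Sum>z | z ^ n = 1. \<Sum>w | w ^ (m div orbit z) = 1.
        real (root_order z * root_order w) / (if z ^ s = z then 1 else 2))"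
      unfolding weights_def
    proof (rule sum.Sigma[symmetric, OF fin], rule ballI)
      fix z assume "z \<in> {z :: complex. z ^ n = 1}"
      then have "m div orbit z > 0" using dvd_div_eq_0_iff[OF orbit_dvd] m by simp
      then show "finite {w :: complex. w ^ (m div orbit z) = 1}" by (simp add: finite_roots_unity)
    qed
    then show ?thesis using sum_codegrees_le by (simp only: psi)
  qed
  also have "\<dots> \<le> (\<Sum>z | z ^ n = 1.
      real (root_order z) * (order_sum m * (if z ^ s = z then 1 else 1 / 6)))"
    by (rule sum_mono) (use term_le in auto)
  also have "\<dots> = order_sum m * (A + B / 6)"
  proof -
    have split: "{z. z ^ n = 1} = {z. z ^ n = 1 \<and> z ^ s = z} \<union> {z :: complex. z ^ n = 1 \<and> z ^ s \<noteq> z}"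
      by auto
    show ?thesis unfolding split
      by (subst sum.union_disjoint)
        (use fin in \<open>auto simp: A_def B_def distrib_left sum_distrib_left sum_divide_distrib mult_ac\<close>)
  qed
  also have "A + B / 6 \<le> 2 / 7 * order_sum n" using AB A7 by simp
  then have "order_sum m * (A + B / 6) \<le> order_sum m * (2 / 7 * order_sum n)"
    using order_sum_pos[OF m] by (intro mult_left_mono) auto
  finally show ?thesis by (simp add: mult_ac)
qed

section \<open>Characters of cyclic groups\<close>

lemma codegree_nonneg: 
  assumes "group G" "\<chi> \<in> Irr G"
  shows "codegree G \<chi> \<ge> 0"
proof -
  interpret group G by fact
  obtain d \<rho> where irr: "irreducible_representation G d \<rho>" and \<chi>: "\<chi> = character G \<rho>"
    using assms(2) by (auto simp: Irr_def)
  have "representation G d \<rho>" using irr by (simp add: irreducible_representation_def)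
  then have "\<rho> \<one>\<^bsub>G\<^esub> = 1\<^sub>m d" by (rule representation_one[OF assms(1)])
  then have "\<chi> \<one>\<^bsub>G\<^esub> = of_nat d" by (simp add: character_def \<chi>)
  then show ?thesis by (simp add: codegree_def)
qed

lemma linear_representation_irreducible:
  assumes hom: "\<And>g h. g \<in> carrier G \<Longrightarrow> h \<in> carrier G \<Longrightarrow> f (g \<otimes>\<^bsub>G\<^esub> h) = f g * f h"
    and nz: "\<And>g. g \<in> carrier G \<Longrightarrow> f g \<noteq> (0 :: complex)"
  shows "irreducible_representation G 1 (\<lambda>g. mat 1 1 (\<lambda>_. f g))"
proof -
  let ?\<rho> = "\<lambda>g. mat 1 1 (\<lambda>_. f g)"
  have mult: "mat 1 1 (\<lambda>_. a) * mat 1 1 (\<lambda>_. b) = mat 1 1 (\<lambda>_. a * b)" for a b :: complex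
    by (intro eq_matI) (auto simp: scalar_prod_def)
  have unit: "?\<rho> g \<in> Units (ring_mat TYPE(complex) 1 ())" if "g \<in> carrier G" for g
  proof -
    have "mat 1 1 (\<lambda>_. 1) = (1\<^sub>m 1 :: complex mat)" by (intro eq_matI) auto
    then show ?thesis using nz[OF that]
      by (auto simp: Units_def ring_mat_simps mult simp del: One_nat_def intro!: bexI[of _ "mat 1 1 (\<lambda>_. inverse (f g))"])
  qed
  have "representation G 1 ?\<rho>"
    unfolding representation_def
    by (rule homI) (simp_all add: units_of_carrier units_of_mult unit ring_mat_simps mult hom del: One_nat_def)
  moreover have "W = {0\<^sub>v 1} \<or> W = carrier_vec 1"
    if W: "VectorSpace.subspace class_ring W (module_vec TYPE(complex) 1)" for W
  proof -
    have sub: "submodule class_ring W (module_vec TYPE(complex) 1)"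
      by (rule VectorSpace.subspace.submod[OF W])
    have Wc: "W \<subseteq> carrier_vec 1" and W0: "0\<^sub>v 1 \<in> W"
      and Ws: "\<And>c v. v \<in> W \<Longrightarrow> c \<cdot>\<^sub>v v \<in> W"
      using submodule.subset[OF sub] submodule.zero_closed[OF sub] submodule.smult_closed[OF sub]
      by (simp_all add: module_vec_simps class_ring_simps)
    have "carrier_vec 1 \<subseteq> W" if v: "v \<in> W" "v \<noteq> 0\<^sub>v 1" for v
    proof
      fix u :: "complex vec" assume u: "u \<in> carrier_vec 1"
      have vc: "v \<in> carrier_vec 1" using v Wc by blast
      then have "v $ 0 \<noteq> 0" using v(2) by (auto simp: vec_eq_iff)
      then have "u = (u $ 0 / v $ 0) \<cdot>\<^sub>v v" using u vc by (auto simp: vec_eq_iff)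
      then show "u \<in> W" using Ws[OF v(1)] by metis
    qed
    then show ?thesis using Wc W0 by blast
  qed
  ultimately show ?thesis by (auto simp: irreducible_representation_def)
qed

text \<open>The characters \<open>g \<mapsto> w ^ g\<close> for the \<open>k\<close>-th roots of unity \<open>w\<close> are distinct, and the kernel of such
a character has at least \<open>o w\<close> cosets, represented by \<open>0, \<dots>, o w - 1\<close>. That the set of all
irreducible characters is finite comes from the weights of the group generated by \<open>x = 1\<close> and
\<open>y = 0\<close>.\<close>

lemma order_sum_le_sum_codegrees_integer_mod_group:
  assumes k: "k > 0"
  shows "order_sum k \<le> sum_codegrees (integer_mod_group k)"
proof -
  let ?Z = "integer_mod_group k"
  have carr: "carrier ?Z = {0..<int k}" using k by (simp add: carrier_integer_mod_group)
  have gr: "group ?Z" by simp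
  \<comment> \<open>The generator is written \<open>1 mod k\<close> because for \<open>k = 1\<close> the number 1 is not in the carrier.\<close>
  interpret Z: split_metacyclic ?Z "1 mod int k" 0 k 1 1
  proof (intro split_metacyclic.intro split_metacyclic_axioms.intro gr)
    fix g assume "g \<in> carrier ?Z"
    then have "g = (1 mod int k) [^]\<^bsub>?Z\<^esub> nat g \<otimes>\<^bsub>?Z\<^esub> 0 [^]\<^bsub>?Z\<^esub> (0::nat)"
      using k by (auto simp: carr mod_mult_right_eq)
    then show "\<exists>(i::nat) (j::nat). g = (1 mod int k) [^]\<^bsub>?Z\<^esub> i \<otimes>\<^bsub>?Z\<^esub> 0 [^]\<^bsub>?Z\<^esub> j" by blast
  qed (use k in \<open>auto simp: carr mod_mult_right_eq\<close>)
  define \<chi> where "\<chi> w = character ?Z (\<lambda>g. mat 1 1 (\<lambda>_. w ^ nat g))" for w :: complex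
  have val: "\<chi> w g = w ^ nat g" if "g \<in> carrier ?Z" for w g
    using that by (simp add: \<chi>_def character_def mat_trace_def)
  have hom: "w ^ nat ((g + h) mod int k) = w ^ nat g * w ^ nat h"
    if "w ^ k = 1" "0 \<le> g" "0 \<le> h" for w :: complex and g h
  proof -
    have "nat ((g + h) mod int k) = (nat g + nat h) mod k"
      using that by (simp add: nat_mod_distrib nat_add_distrib)
    moreover have "w ^ ((nat g + nat h) mod k) = w ^ (nat g + nat h)"
      by (rule power_cong_root_unity[OF that(1)]) (simp add: cong_def)
    ultimately show ?thesis by (simp add: power_add)
  qed
  have irr: "\<chi> w \<in> Irr ?Z" if w: "w ^ k = 1" for w
  proof -
    have "w \<noteq> 0" using w k by (auto simp: power_0_left)
    then have "irreducible_representation ?Z 1 (\<lambda>g. mat 1 1 (\<lambda>_. w ^ nat g))"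
      by (intro linear_representation_irreducible) (auto simp: carr hom[OF w])
    then show ?thesis by (auto simp: Irr_def \<chi>_def)
  qed
  have inj: "inj_on \<chi> {w. w ^ k = 1}"
  proof (rule inj_onI, clarsimp)
    fix w w' :: complex assume w: "w ^ k = 1" "w' ^ k = 1" and eq: "\<chi> w = \<chi> w'"
    show "w = w'"
    proof (cases "k = 1")
      case False
      then have "1 \<in> carrier ?Z" using k by (simp add: carr)
      then have "\<chi> w 1 = w" "\<chi> w' 1 = w'" by (simp_all add: val)
      then show ?thesis using eq by metis
    next
      case True
      then show ?thesis using w by simp
    qed
  qed
  have cod: "real (root_order w) \<le> codegree ?Z (\<chi> w)" if w: "w ^ k = 1" for w
  proof -
    define K where "K = char_kernel ?Z (\<chi> w)"
    have zero: "0 \<in> carrier ?Z" by simp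
    have K: "g \<in> K \<longleftrightarrow> g \<in> carrier ?Z \<and> w ^ nat g = 1" for g
      using val zero by (auto simp: K_def char_kernel_def)
    have ok: "root_order w \<le> k" using root_order_le[OF w k] .
    have jc: "int j \<in> carrier ?Z" if "j < root_order w" for j using that ok by (simp add: carr)
    have "inj_on (\<lambda>j. K #>\<^bsub>?Z\<^esub> int j) {..<root_order w}"
    proof (rule inj_onI)
      fix j j' assume "j \<in> {..<root_order w}" "j' \<in> {..<root_order w}"
        and eq: "K #>\<^bsub>?Z\<^esub> int j = K #>\<^bsub>?Z\<^esub> int j'"
      then have j: "j < root_order w" "j' < root_order w" by simp_all
      have "0 \<in> K" using K zero by simp
      then have "int j \<in> K #>\<^bsub>?Z\<^esub> int j"
        using jc[OF j(1)] by (force simp: r_coset_def carr)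
      then obtain a where a: "a \<in> K" "int j = (a + int j') mod int k"
        unfolding eq by (auto simp: r_coset_def)
      have "w ^ j = w ^ nat ((a + int j') mod int k)" using a(2) by (metis nat_int)
      also have "\<dots> = w ^ nat a * w ^ j'" using a(1) hom[OF w, of a "int j'"] K by (simp add: carr)
      finally have "w ^ j = w ^ j'" using a(1) K by simp
      moreover have "w \<noteq> 0" using w k by (auto simp: power_0_left)
      ultimately have "w ^ (j - j') = 1" "w ^ (j' - j) = 1"
        by (cases "j \<le> j'", simp_all add: power_diff)+
      then have "root_order w dvd j - j'" "root_order w dvd j' - j"
        using root_order_dvd_iff[OF w k] by auto
      then show "j = j'" using j by (metis diff_is_0_eq dvd_imp_le le_antisym less_imp_diff_less 
            linorder_not_less not_gr_zero)
    qed
    moreover have "(\<lambda>j. K #>\<^bsub>?Z\<^esub> int j) ` {..<root_order w} \<subseteq> rcosets\<^bsub>?Z\<^esub> K"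
      using jc by (auto simp: RCOSETS_def)
    moreover have "finite (rcosets\<^bsub>?Z\<^esub> K)" by (simp add: RCOSETS_def carr)
    ultimately have "root_order w \<le> card (rcosets\<^bsub>?Z\<^esub> K)"
      by (metis card_inj_on_le card_lessThan)
    then show ?thesis using val[OF zero] by (simp add: codegree_def K_def)
  qed
  have "order_sum k \<le> (\<Sum>w | w ^ k = 1. codegree ?Z (\<chi> w))"
    unfolding order_sum_def by (rule sum_mono) (use cod in auto)
  also have "\<dots> = (\<Sum>c\<in>\<chi> ` {w. w ^ k = 1}. codegree ?Z c)"
    using inj by (simp add: sum.reindex)
  also have "\<dots> \<le> sum_codegrees ?Z"
    unfolding sum_codegrees_def
    using irr codegree_nonneg[OF gr] by (intro sum_mono2 Z.finite_Irr) auto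
  finally show ?thesis .
qed

section \<open>Semidirect products of cyclic groups\<close>

lemma (in group) cyclic_subgroup_generator:
  assumes H: "subgroup H G" and cyc: "cyclic_group (G\<lparr>carrier := H\<rparr>)" and k: "card H = k" "k > 0"
  obtains x where "x \<in> H" "ord x = k" "\<forall>h\<in>H. \<exists>i :: nat. h = x [^] i"
proof -
  interpret H: group "G\<lparr>carrier := H\<rparr>" using subgroup_imp_group[OF H] .
  obtain x where x: "x \<in> H" and "H = range (\<lambda>n::int. x [^]\<^bsub>G\<lparr>carrier := H\<rparr>\<^esub> n)"
    using cyc H.cyclic_group by auto
  then have "H = range (\<lambda>n::int. x [^] n)" using int_pow_consistent[OF H x] by simp
  moreover have xG: "x \<in> carrier G" using x subgroup.subset[OF H] by blast
  ultimately have gen: "H = generate G {x}" using generate_pow[OF xG] by auto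
  then have ord: "ord x = k" using generate_pow_card[OF xG] k by simp
  then have "H = {x [^] i | i. i \<in> (UNIV :: nat set)}" using gen generate_pow_nat[OF xG] k by simp
  then show thesis using that[OF x ord] by blast
qed

lemma (in group) nat_pow_eq_iff_cong:
  assumes "x \<in> carrier G"
  shows "x [^] (i :: nat) = x [^] (j :: nat) \<longleftrightarrow> [i = j] (mod ord x)"
proof -
  have "x [^] i = x [^] j \<longleftrightarrow> int (ord x) dvd (int j - int i)"
    using int_pow_eq[OF assms, of "int i" "int j"] by (simp add: int_pow_int)
  also have "\<dots> \<longleftrightarrow> [int j = int i] (mod int (ord x))" by (simp add: cong_iff_dvd_diff)
  finally show ?thesis by (simp add: cong_int_iff cong_sym_eq)
qed

theorem theorem1p2:
  fixes G :: "('a, 'b) monoid_scheme" and N H :: "'a set" and n m :: nat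
  assumes "n > 0" and "m > 0" and "gcd n m = 1"
    and "group G"
    and "semidirect_product G N H"
    and "cyclic_group (G\<lparr>carrier := N\<rparr>)" and "card N = n"
    and "cyclic_group (G\<lparr>carrier := H\<rparr>)" and "card H = m"
    and "\<not> H \<lhd> G"
  shows "sum_codegrees G < 8 / 21 * sum_codegrees (integer_mod_group (n * m))"
proof -
  interpret group G by fact
  have N: "N \<lhd> G" and H: "subgroup H G" and NH: "N <#>\<^bsub>G\<^esub> H = carrier G"
    using assms(5) by (auto simp: semidirect_product_def)
  have Ns: "subgroup N G" using N by (rule normal_imp_subgroup)
  obtain x where x: "x \<in> N" "ord x = n" "\<forall>h\<in>N. \<exists>i :: nat. h = x [^]\<^bsub>G\<^esub> i"
    using cyclic_subgroup_generator[OF Ns assms(6,7,1)] .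
  obtain y where y: "y \<in> H" "ord y = m" "\<forall>h\<in>H. \<exists>i :: nat. h = y [^]\<^bsub>G\<^esub> i"
    using cyclic_subgroup_generator[OF H assms(8,9,2)] .
  have xG: "x \<in> carrier G" and yG: "y \<in> carrier G"
    using x y subgroup.subset[OF Ns] subgroup.subset[OF H] by auto
  have xn: "x [^]\<^bsub>G\<^esub> n = \<one>\<^bsub>G\<^esub>" and ym: "y [^]\<^bsub>G\<^esub> m = \<one>\<^bsub>G\<^esub>"
    using pow_ord_eq_1 x(2) y(2) xG yG by auto
  have "inv\<^bsub>G\<^esub> y \<otimes>\<^bsub>G\<^esub> x \<otimes>\<^bsub>G\<^esub> y \<in> N" using normal.inv_op_closed1[OF N yG x(1)] .
  then obtain s0 :: nat where s0: "inv\<^bsub>G\<^esub> y \<otimes>\<^bsub>G\<^esub> x \<otimes>\<^bsub>G\<^esub> y = x [^]\<^bsub>G\<^esub> s0" using x(3) by blast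
  \<comment> \<open>Adding \<open>n\<close> makes the exponent positive, so that \<open>s - 1\<close> is an honest difference.\<close>
  define s where "s = s0 + n"
  have "x [^]\<^bsub>G\<^esub> s = x [^]\<^bsub>G\<^esub> s0" using xG by (simp add: s_def xn flip: nat_pow_mult)
  then have "y \<otimes>\<^bsub>G\<^esub> x [^]\<^bsub>G\<^esub> s = y \<otimes>\<^bsub>G\<^esub> (inv\<^bsub>G\<^esub> y \<otimes>\<^bsub>G\<^esub> (x \<otimes>\<^bsub>G\<^esub> y))"
    using s0 xG yG by (simp add: m_assoc)
  then have conj: "x \<otimes>\<^bsub>G\<^esub> y = y \<otimes>\<^bsub>G\<^esub> x [^]\<^bsub>G\<^esub> s" using xG yG by (simp flip: m_assoc)
  have "x [^]\<^bsub>G\<^esub> (1::nat) \<otimes>\<^bsub>G\<^esub> y [^]\<^bsub>G\<^esub> m = y [^]\<^bsub>G\<^esub> m \<otimes>\<^bsub>G\<^esub> x [^]\<^bsub>G\<^esub> (s ^ m * 1)"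
    by (rule pow_conj_pow[OF xG yG conj])
  then have "x [^]\<^bsub>G\<^esub> (s ^ m) = x [^]\<^bsub>G\<^esub> (1::nat)" using xG by (simp add: ym)
  then have sm: "[s ^ m = 1] (mod n)" using nat_pow_eq_iff_cong[OF xG] x(2) by metis
  have carr: "\<exists>(i::nat) (j::nat). g = x [^]\<^bsub>G\<^esub> i \<otimes>\<^bsub>G\<^esub> y [^]\<^bsub>G\<^esub> j" if g: "g \<in> carrier G" for g
  proof -
    have "g \<in> N <#>\<^bsub>G\<^esub> H" using g NH by simp
    then obtain a b where "a \<in> N" "b \<in> H" "g = a \<otimes>\<^bsub>G\<^esub> b" by (auto simp: set_mult_def)
    moreover obtain i j :: nat where "a = x [^]\<^bsub>G\<^esub> i" "b = y [^]\<^bsub>G\<^esub> j"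
      using x(3) y(3) calculation by blast
    ultimately show ?thesis by blast
  qed
  \<comment> \<open>If \<open>x\<close> and \<open>y\<close> commuted, \<open>G\<close> would be abelian and \<open>H\<close> normal.\<close>
  have nontriv: "\<not> [s = 1] (mod n)"
  proof
    assume s1: "[s = 1] (mod n)"
    have "H \<lhd> G"
      unfolding normal_inv_iff
    proof (intro conjI ballI H)
      fix g h assume g: "g \<in> carrier G" and h: "h \<in> H"
      obtain i j :: nat where ij: "g = x [^]\<^bsub>G\<^esub> i \<otimes>\<^bsub>G\<^esub> y [^]\<^bsub>G\<^esub> j" using carr[OF g] by blast
      obtain l :: nat where l: "h = y [^]\<^bsub>G\<^esub> l" using y(3) h by blast
      have hG: "h \<in> carrier G" using yG l by simp
      have "[s ^ l * i = i] (mod n)"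
        using cong_scalar_right[OF cong_pow[OF s1, of l], of i] by simp
      then have "x [^]\<^bsub>G\<^esub> (s ^ l * i) = x [^]\<^bsub>G\<^esub> i" using nat_pow_eq_iff_cong[OF xG] x(2) by metis
      then have "x [^]\<^bsub>G\<^esub> i \<otimes>\<^bsub>G\<^esub> h = h \<otimes>\<^bsub>G\<^esub> x [^]\<^bsub>G\<^esub> i"
        using pow_conj_pow[OF xG yG conj, of i l] l by simp
      moreover have "y [^]\<^bsub>G\<^esub> j \<otimes>\<^bsub>G\<^esub> h = h \<otimes>\<^bsub>G\<^esub> y [^]\<^bsub>G\<^esub> j"
        using yG by (simp add: l nat_pow_mult add.commute)
      ultimately have "g \<otimes>\<^bsub>G\<^esub> h = h \<otimes>\<^bsub>G\<^esub> g"
        using xG yG hG unfolding ij by (metis m_assoc nat_pow_closed)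
      then have "g \<otimes>\<^bsub>G\<^esub> h \<otimes>\<^bsub>G\<^esub> inv\<^bsub>G\<^esub> g = h" using g hG by (simp add: m_assoc)
      then show "g \<otimes>\<^bsub>G\<^esub> h \<otimes>\<^bsub>G\<^esub> inv\<^bsub>G\<^esub> g \<in> H" using h by simp
    qed
    then show False using assms(10) by simp
  qed
  have cop: "coprime n m" using assms(3) by (simp add: coprime_iff_gcd_eq_1)
  interpret split_metacyclic G x y n m s
    by unfold_locales (use xG yG assms(1,2) xn ym conj sm carr in auto)
  have "sum_codegrees G \<le> 2 / 7 * (order_sum n * order_sum m)"
    using sum_codegrees_le_two_sevenths[OF cop nontriv] assms(1) by (simp add: s_def)
  also have "\<dots> < 8 / 21 * (order_sum n * order_sum m)"
    using order_sum_pos[OF assms(1)] order_sum_pos[OF assms(2)] by simp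
  also have "\<dots> \<le> 8 / 21 * order_sum (n * m)"
    by (rule mult_left_mono[OF order_sum_mult_le[OF cop assms(1,2)]]) simp
  also have "\<dots> \<le> 8 / 21 * sum_codegrees (integer_mod_group (n * m))"
    using order_sum_le_sum_codegrees_integer_mod_group[of "n * m"] assms(1,2) by simp
  finally show ?thesis .
qed

end
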